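(* Let $X$ be a triangulable space, $G$ a subgroup of $\operatorname{Homeo}(X)$, and $(\bar C,\partial)$ a $G$-chain subcomplex of the singular chain complex $(S(X),\partial)$ over a field $\mathbb{K}$ satisfying property $( * )$. Let $\varphi,\psi:X\to\mathbb{R}^k$ be continuous, with induced filtering functions $\bar\varphi,\bar\psi$ on $\bar C$. Then for every $n\in\mathbb{Z}$, $$D_{match}(\rho^{\bar\varphi}_n,\rho^{\bar\psi}_n)\le d_G(\varphi,\psi).$$
   Context: Order on $\mathbb{R}^k$: $u\preceq v$ iff $u_j\le v_j$ for all $j$; $u\prec v$ iff $u_j<v_j$ for all $j$; $X^{\varphi\preceq u}=\{x:\varphi(x)\preceq u\}$. Natural pseudo-distance: $d_G(\varphi,\psi)=\inf_{g\in G}\max_{x\in X}\|\varphi(x)-\psi(g(x))\|_\infty$. $G$ acts on $S(X)$ by $g(\sigma)=g\circ\sigma$, extended linearly; a $G$-chain subcomplex $\bar C$ of $S(X)$ is a chain subcomplex on which each $g\in G$ restricts to a chain isomorphism. For $Y\subseteq X$, $\bar C\cap S(Y)$ is the complex of singular chains in $Y$ lying in $\bar C$. Property $( * )$: whenever $X',X''$ are closed subsets of $X$ with $X'\subseteq\operatorname{int}(X'')$, there is a subspace $\hat X$ with $X'\subseteq\hat X\subseteq X''$ such that $H_n(\bar C\cap S(\hat X))$ is finitely generated for every $n\ge0$. Induced filtering function: $\bar\varphi(0)=(-\infty,\ldots,-\infty)$; for a non-null chain $c=\sum_{r=1}^m a^r\sigma_{j_r}$ in reduced form (distinct singular simplices,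 all $a^r\ne0$), the $i$-th component of $\bar\varphi(c)$ is $\max$ of $\varphi_i$ on $\bigcup_r\sigma_{j_r}(\Delta_n)$. PBNF: for $u\prec v$, $\rho^{\bar\varphi}_n(u,v)$ is the rank of the image of $H_n(\bar C^{\bar\varphi\preceq u})\to H_n(\bar C^{\bar\varphi\preceq v})$ induced by inclusion, where $\bar C^{\bar\varphi\preceq u}_n=\{c\in\bar C_n:\bar\varphi(c)\preceq u\}$; these ranks are finite. Two PBNFs are identified if they differ on a set of measure zero. $D_{match}$ is the matching (bottleneck) distance between PBNFs: for $k=1$ it is the bottleneck distance between the persistence diagrams (multisets of cornerpoints, with the diagonal counted with infinite multiplicity, distance measured by the max-norm) determined by the PBNFs; for $k>1$ it is the multidimensional matching distance $\sup_{(\vec l,\vec b)}\min_i l_i\cdot D_{match}(\rho_{(\vec l,\vec b)},\rho'_{(\vec l,\vec b)})$, the supremum over pairs with $\vec l\in\mathbb{R}^k$, $l_i>0$, $\|\vec l\|=1$, $\vec b\in\mathbb{R}^k$, $\sum_i b_i=0$, where $\rho_{(\vec l,\vec b)}(s,t)=\rho(s\vec l+\vec b,t\vec l+\vec b)$ for $s<t$. *)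

theory Defs
  imports "HOL-Analysis.Analysis"
begin

text \<open>X is triangulable via the finite simplicial complex K (in some Euclidean space).
  In the theorem, K and its ambient type are universally quantified, which amounts to
  assuming that some triangulation exists.\<close>
definition triangulated_by :: "'a topology \<Rightarrow> 'b::euclidean_space set set \<Rightarrow> bool" where
  "triangulated_by X K \<longleftrightarrow>
     simplicial_complex K \<and> X homeomorphic_space subtopology euclidean (\<Union>K)"

text \<open>Homeomorphisms of X, normalised to be the identity outside the carrier, so that
  composition and inverse are the genuine group operations.\<close>
definition Homeo :: "'a topology \<Rightarrow> ('a \<Rightarrow> 'a) set" where
  "Homeo X = {g. homeomorphic_map X X g \<and> (\<forall>x. x \<notin> topspace X \<longrightarrow> g x = x)}"

definition homeo_subgroup :: "'a topology \<Rightarrow> ('a \<Rightarrow> 'a) set \<Rightarrow> bool" where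
  "homeo_subgroup X G \<longleftrightarrow> G \<subseteq> Homeo X \<and> id \<in> G \<and>
     (\<forall>g\<in>G. \<forall>h\<in>G. g \<circ> h \<in> G) \<and> (\<forall>g\<in>G. inv g \<in> G)"

definition std_simplex :: "nat \<Rightarrow> (nat \<Rightarrow> real) set" where
  "std_simplex n = {x. (\<forall>i. 0 \<le> x i) \<and> (\<forall>i>n. x i = 0) \<and> sum x {..n} = 1}"

definition sing_simplex :: "nat \<Rightarrow> 'a topology \<Rightarrow> ((nat \<Rightarrow> real) \<Rightarrow> 'a) \<Rightarrow> bool" where
  "sing_simplex n X \<sigma> \<longleftrightarrow>
     continuous_map (subtopology (powertop_real UNIV) (std_simplex n)) X \<sigma> \<and>
     \<sigma> \<in> extensional (std_simplex n)"

definition simp_face :: "nat \<Rightarrow> (nat \<Rightarrow> real) \<Rightarrow> (nat \<Rightarrow> real)" where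
  "simp_face k x = (\<lambda>i. if i < k then x i else if i = k then 0 else x (i - 1))"

definition sing_face :: "nat \<Rightarrow> nat \<Rightarrow> ((nat \<Rightarrow> real) \<Rightarrow> 'a) \<Rightarrow> ((nat \<Rightarrow> real) \<Rightarrow> 'a)" where
  "sing_face n k \<sigma> = restrict (\<sigma> \<circ> simp_face k) (std_simplex (n - 1))"

type_synonym ('a, 'k) chain = "((nat \<Rightarrow> real) \<Rightarrow> 'a) \<Rightarrow> 'k"

definition supp :: "('a, 'k::zero) chain \<Rightarrow> ((nat \<Rightarrow> real) \<Rightarrow> 'a) set" where
  "supp c = {\<sigma>. c \<sigma> \<noteq> 0}"

definition chains :: "nat \<Rightarrow> 'a topology \<Rightarrow> ('a, 'k::field) chain set" where
  "chains n X = {c. finite (supp c) \<and> (\<forall>\<sigma>\<in>supp c. sing_simplex n X \<sigma>)}"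

definition chains_in :: "nat \<Rightarrow> 'a topology \<Rightarrow> 'a set \<Rightarrow> ('a, 'k::field) chain set" where
  "chains_in n X Y = {c \<in> chains n X. \<forall>\<sigma>\<in>supp c. \<sigma> ` std_simplex n \<subseteq> Y}"

definition bd :: "nat \<Rightarrow> ('a, 'k::field) chain \<Rightarrow> ('a, 'k) chain" where
  "bd n c = (if n = 0 then (\<lambda>_. 0) else
     (\<lambda>\<tau>. \<Sum>\<sigma>\<in>supp c. c \<sigma> * (\<Sum>j\<in>{j. j \<le> n \<and> sing_face n j \<sigma> = \<tau>}. (-1) ^ j)))"

definition lspan :: "('a, 'k::field) chain set \<Rightarrow> ('a, 'k) chain set" where
  "lspan S = {(\<lambda>\<sigma>. \<Sum>v\<in>T. a v * v \<sigma>) | T a. finite T \<and> T \<subseteq> S}"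

definition lsubspace :: "('a, 'k::field) chain set \<Rightarrow> bool" where
  "lsubspace S \<longleftrightarrow> (\<lambda>_. 0) \<in> S \<and> (\<forall>c\<in>S. \<forall>d\<in>S. (\<lambda>\<sigma>. c \<sigma> + d \<sigma>) \<in> S) \<and>
     (\<forall>a. \<forall>c\<in>S. (\<lambda>\<sigma>. a * c \<sigma>) \<in> S)"

text \<open>Dimension of the quotient Z/W (W a subspace of the subspace Z): least number of
  elements of Z which together with W span Z.\<close>
definition qrank :: "('a, 'k::field) chain set \<Rightarrow> ('a, 'k) chain set \<Rightarrow> nat" where
  "qrank Z W = (LEAST m. \<exists>S. finite S \<and> S \<subseteq> Z \<and> card S = m \<and> Z \<subseteq> lspan (S \<union> W))"

definition simp_act :: "nat \<Rightarrow> ('a \<Rightarrow> 'a) \<Rightarrow> ((nat \<Rightarrow> real) \<Rightarrow> 'a) \<Rightarrow> ((nat \<Rightarrow> real) \<Rightarrow> 'a)" where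
  "simp_act n g \<sigma> = restrict (g \<circ> \<sigma>) (std_simplex n)"

definition chain_act :: "nat \<Rightarrow> ('a \<Rightarrow> 'a) \<Rightarrow> ('a, 'k::field) chain \<Rightarrow> ('a, 'k) chain" where
  "chain_act n g c = (\<lambda>\<tau>. \<Sum>\<sigma>\<in>{\<sigma>\<in>supp c. simp_act n g \<sigma> = \<tau>}. c \<sigma>)"

text \<open>Cbar n is the degree-n part of the subcomplex (degrees < 0 are zero).\<close>
definition G_chain_subcomplex ::
    "'a topology \<Rightarrow> ('a \<Rightarrow> 'a) set \<Rightarrow> (nat \<Rightarrow> ('a, 'k::field) chain set) \<Rightarrow> bool" where
  "G_chain_subcomplex X G Cbar \<longleftrightarrow>
     (\<forall>n. Cbar n \<subseteq> chains n X \<and> lsubspace (Cbar n)) \<and>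
     (\<forall>n. \<forall>c\<in>Cbar (Suc n). bd (Suc n) c \<in> Cbar n) \<and>
     (\<forall>g\<in>G. \<forall>n. chain_act n g ` Cbar n = Cbar n)"

definition fg_homology_in ::
    "'a topology \<Rightarrow> (nat \<Rightarrow> ('a, 'k::field) chain set) \<Rightarrow> 'a set \<Rightarrow> nat \<Rightarrow> bool" where
  "fg_homology_in X Cbar Y n \<longleftrightarrow>
     (let Z = {c \<in> Cbar n \<inter> chains_in n X Y. bd n c = (\<lambda>_. 0)};
          B = bd (Suc n) ` (Cbar (Suc n) \<inter> chains_in (Suc n) X Y)
      in \<exists>S. finite S \<and> S \<subseteq> Z \<and> Z \<subseteq> lspan (S \<union> B))"

definition property_star :: "'a topology \<Rightarrow> (nat \<Rightarrow> ('a, 'k::field) chain set) \<Rightarrow> bool" where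
  "property_star X Cbar \<longleftrightarrow>
     (\<forall>X' X''. closedin X X' \<and> closedin X X'' \<and> X' \<subseteq> X interior_of X'' \<longrightarrow>
        (\<exists>Y. X' \<subseteq> Y \<and> Y \<subseteq> X'' \<and> (\<forall>n. fg_homology_in X Cbar Y n)))"

definition induced_filt ::
    "('a \<Rightarrow> real^'m) \<Rightarrow> nat \<Rightarrow> ('a, 'k::field) chain \<Rightarrow> ereal^'m" where
  "induced_filt \<phi> n c = (if c = (\<lambda>_. 0) then (\<chi> i. -\<infinity>) else
     (\<chi> i. Sup ((\<lambda>x. ereal (\<phi> x $ i)) ` (\<Union>\<sigma>\<in>supp c. \<sigma> ` std_simplex n))))"

definition ev_le :: "ereal^'m \<Rightarrow> real^'m \<Rightarrow> bool" where
  "ev_le a u \<longleftrightarrow> (\<forall>i. a $ i \<le> ereal (u $ i))"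

definition sublevel_chains ::
    "(nat \<Rightarrow> ('a, 'k::field) chain set) \<Rightarrow> ('a \<Rightarrow> real^'m) \<Rightarrow> nat \<Rightarrow> real^'m \<Rightarrow> ('a, 'k) chain set" where
  "sublevel_chains Cbar \<phi> n u = {c \<in> Cbar n. ev_le (induced_filt \<phi> n c) u}"

text \<open>rank of H_n(Cbar^{<=u}) -> H_n(Cbar^{<=v}): image = Z_n(u) / (Z_n(u) \<inter> B_n(v)).
  In negative degrees the chain groups vanish, so the rank is 0.\<close>
definition PBNF ::
    "(nat \<Rightarrow> ('a, 'k::field) chain set) \<Rightarrow> ('a \<Rightarrow> real^'m) \<Rightarrow> int \<Rightarrow> real^'m \<Rightarrow> real^'m \<Rightarrow> nat" where
  "PBNF Cbar \<phi> n u v = (if n < 0 then 0 else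
     (let m = nat n;
          Z = {c \<in> sublevel_chains Cbar \<phi> m u. bd m c = (\<lambda>_. 0)};
          B = bd (Suc m) ` sublevel_chains Cbar \<phi> (Suc m) v
      in qrank Z (Z \<inter> B)))"

definition mult_proper :: "(real \<Rightarrow> real \<Rightarrow> nat) \<Rightarrow> real \<Rightarrow> real \<Rightarrow> nat" where
  "mult_proper \<rho> u v = nat (Inf {int (\<rho> (u+e) (v-e)) - int (\<rho> (u-e) (v-e))
        - int (\<rho> (u+e) (v+e)) + int (\<rho> (u-e) (v+e)) | e. e > 0 \<and> u + e < v - e})"

definition mult_inf :: "(real \<Rightarrow> real \<Rightarrow> nat) \<Rightarrow> real \<Rightarrow> nat" where
  "mult_inf \<rho> u = nat (Inf {int (\<rho> (u+e) (1/e)) - int (\<rho> (u-e) (1/e)) | e. e > 0 \<and> u + e < 1/e})"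

definition pdiag :: "(real \<Rightarrow> real \<Rightarrow> nat) \<Rightarrow> real \<times> ereal \<Rightarrow> nat" where
  "pdiag \<rho> p = (if snd p = \<infinity> then mult_inf \<rho> (fst p)
     else if ereal (fst p) < snd p then mult_proper \<rho> (fst p) (real_of_ereal (snd p)) else 0)"

definition cdist :: "real \<times> ereal \<Rightarrow> real \<times> ereal \<Rightarrow> ereal" where
  "cdist p q = (if snd p = \<infinity> \<and> snd q = \<infinity> then ereal \<bar>fst p - fst q\<bar>
     else if snd p = \<infinity> \<or> snd q = \<infinity> then \<infinity>
     else ereal (max \<bar>fst p - fst q\<bar> \<bar>real_of_ereal (snd p) - real_of_ereal (snd q)\<bar>))"

definition ddiag :: "real \<times> ereal \<Rightarrow> ereal" where
  "ddiag p = (if snd p = \<infinity> then \<infinity> else ereal ((real_of_ereal (snd p) - fst p) / 2))"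

definition labelled :: "(real \<times> ereal \<Rightarrow> nat) \<Rightarrow> ((real \<times> ereal) \<times> nat) set" where
  "labelled D = {(p, j). j < D p}"

text \<open>Partial matchings between the multisets; unmatched points go to the diagonal.\<close>
definition is_matching ::
    "(real \<times> ereal \<Rightarrow> nat) \<Rightarrow> (real \<times> ereal \<Rightarrow> nat) \<Rightarrow> (((real \<times> ereal) \<times> nat) \<times> ((real \<times> ereal) \<times> nat)) set \<Rightarrow> bool" where
  "is_matching D D' M \<longleftrightarrow> M \<subseteq> labelled D \<times> labelled D' \<and>
     (\<forall>a b b'. (a, b) \<in> M \<and> (a, b') \<in> M \<longrightarrow> b = b') \<and>
     (\<forall>a a' b. (a, b) \<in> M \<and> (a', b) \<in> M \<longrightarrow> a = a')"

definition matching_cost ::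
    "(real \<times> ereal \<Rightarrow> nat) \<Rightarrow> (real \<times> ereal \<Rightarrow> nat) \<Rightarrow> (((real \<times> ereal) \<times> nat) \<times> ((real \<times> ereal) \<times> nat)) set \<Rightarrow> ereal" where
  "matching_cost D D' M = Sup ({0} \<union> {cdist (fst a) (fst b) | a b. (a, b) \<in> M}
     \<union> {ddiag (fst a) | a. a \<in> labelled D \<and> a \<notin> fst ` M}
     \<union> {ddiag (fst b) | b. b \<in> labelled D' \<and> b \<notin> snd ` M})"

definition bottleneck :: "(real \<times> ereal \<Rightarrow> nat) \<Rightarrow> (real \<times> ereal \<Rightarrow> nat) \<Rightarrow> ereal" where
  "bottleneck D D' = Inf {matching_cost D D' M | M. is_matching D D' M}"

definition Dmatch1 :: "(real \<Rightarrow> real \<Rightarrow> nat) \<Rightarrow> (real \<Rightarrow> real \<Rightarrow> nat) \<Rightarrow> ereal" where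
  "Dmatch1 \<rho> \<rho>' = bottleneck (pdiag \<rho>) (pdiag \<rho>')"

definition restrict_line ::
    "(real^'m \<Rightarrow> real^'m \<Rightarrow> nat) \<Rightarrow> real^'m \<Rightarrow> real^'m \<Rightarrow> real \<Rightarrow> real \<Rightarrow> nat" where
  "restrict_line \<rho> l b s t = \<rho> (s *\<^sub>R l + b) (t *\<^sub>R l + b)"

definition admissible_pair :: "real^'m \<Rightarrow> real^'m \<Rightarrow> bool" where
  "admissible_pair l b \<longleftrightarrow> (\<forall>i. l $ i > 0) \<and> norm l = 1 \<and> (\<Sum>i\<in>UNIV. b $ i) = 0"

text \<open>Multidimensional matching distance (coincides with Dmatch1 when k = 1).\<close>
definition Dmatch :: "(real^'m \<Rightarrow> real^'m \<Rightarrow> nat) \<Rightarrow> (real^'m \<Rightarrow> real^'m \<Rightarrow> nat) \<Rightarrow> ereal" where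
  "Dmatch \<rho> \<rho>' = (SUP (l, b) \<in> {(l, b). admissible_pair l b}.
      ereal (Min (range (\<lambda>i. l $ i))) * Dmatch1 (restrict_line \<rho> l b) (restrict_line \<rho>' l b))"

definition supnorm :: "real^'m \<Rightarrow> real" where
  "supnorm v = Max (range (\<lambda>i. \<bar>v $ i\<bar>))"

definition nat_pseudo_dist ::
    "'a topology \<Rightarrow> ('a \<Rightarrow> 'a) set \<Rightarrow> ('a \<Rightarrow> real^'m) \<Rightarrow> ('a \<Rightarrow> real^'m) \<Rightarrow> ereal" where
  "nat_pseudo_dist X G \<phi> \<psi> = (INF g\<in>G. Sup ({0} \<union> (\<lambda>x. ereal (supnorm (\<phi> x - \<psi> (g x)))) ` topspace X))"

end

theory Submission
  imports Defs "HOL-Library.Function_Algebras"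
begin

text \<open>Cycles of sublevel sets and boundaries of sublevel sets are two increasing flags \<open>Z\<close>, \<open>B\<close> of
  subspaces of one space of chains, and the persistent Betti number at \<open>(u, v)\<close> is the dimension
  of \<open>Z u\<close> modulo \<open>B v\<close>. Replacing \<open>\<psi>\<close> by \<open>\<psi> \<circ> g\<close> does not change the ranks, so along a line it
  remains to compare \<open>\<epsilon>\<close>-interleaved pairs \<open>(Z\<^sub>1, B\<^sub>1)\<close> and \<open>(Z\<^sub>2, B\<^sub>2)\<close>. The mixed pair \<open>(Z\<^sub>1, B\<^sub>2)\<close>
  shares its cycles, hence its births, with the first pair and its boundaries, hence its deaths,
  with the second. Numbering the bars with a fixed birth by decreasing death matches the first
  barcode with the mixed one, births fixed and deaths moved by at most \<open>\<epsilon>\<close>; numbering the bars with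
  a fixed death by increasing birth matches the mixed barcode with the second one. The composition
  of the two matchings moves every coordinate by at most \<open>\<epsilon>\<close>. Both steps rest on the modular
  inequality for relative dimensions.\<close>

section \<open>Dimension of one set of vectors modulo another\<close>

text \<open>No persistence module is decomposed: a bar is visible only through differences of ranks,
  and cornerpoints may accumulate at the diagonal. For the mixed pair, the inclusion of
  \<open>Z\<^sub>1 u\<close> in \<open>Z\<^sub>2 (u + \<epsilon>)\<close> yields finiteness only for
  u + \<epsilon> < v. Hence the rank functions carry a slack \<open>c\<close>, and the mixed barcode
  shows only bars longer than \<epsilon>. A bar of length at most 2 \<epsilon> may therefore lack a
  partner, but then it lies within \<epsilon> of the diagonal.

  The delicate point is the joint between the two matchings. A cornerpoint of the mixed barcode must
  receive equally many numbers from the birth side and from the death side. The two counts are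
  iterated limits taken in opposite orders, whereas the multiplicity of a cornerpoint is an infimum
  over equal increments of both coordinates. Each count is shown to equal that infimum.\<close>

locale relative_dimension = vector_space
begin

definition relfin :: "'b set \<Rightarrow> 'b set \<Rightarrow> bool" where
  "relfin Z B \<longleftrightarrow> (\<exists>S. finite S \<and> S \<subseteq> Z \<and> Z \<subseteq> span (S \<union> B))"

text \<open>For subspaces this is the dimension of (Z + B)/B. Arbitrary sets are allowed so that the
  union of Z and B can stand for the sum. If no finite \<open>S\<close> exists the
  \<open>LEAST\<close> is unspecified, hence the hypotheses \<open>relfin\<close> below.\<close>

definition reldim :: "'b set \<Rightarrow> 'b set \<Rightarrow> nat" where
  "reldim Z B = (LEAST m. \<exists>S. finite S \<and> S \<subseteq> Z \<and> card S = m \<and> Z \<subseteq> span (S \<union> B))"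

lemma reldim_le: "finite S \<Longrightarrow> S \<subseteq> Z \<Longrightarrow> Z \<subseteq> span (S \<union> B) \<Longrightarrow> reldim Z B \<le> card S"
  unfolding reldim_def by (rule Least_le) blast

lemma reldim_attained:
  assumes "relfin Z B"
  obtains S where "finite S" "S \<subseteq> Z" "card S = reldim Z B" "Z \<subseteq> span (S \<union> B)"
proof -
  have "\<exists>m S. finite S \<and> S \<subseteq> Z \<and> card S = m \<and> Z \<subseteq> span (S \<union> B)"
    using assms unfolding relfin_def by blast
  from LeastI_ex[OF this] show thesis
    using that unfolding reldim_def by blast
qed

lemma relfin_antimono: "relfin Z B \<Longrightarrow> B \<subseteq> B' \<Longrightarrow> relfin Z B'"
  unfolding relfin_def by (meson span_mono Un_mono order_refl subset_trans)

lemma reldim_antimono: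
  assumes "relfin Z B" "B \<subseteq> B'"
  shows "reldim Z B' \<le> reldim Z B"
proof -
  obtain S where S: "finite S" "S \<subseteq> Z" "card S = reldim Z B" "Z \<subseteq> span (S \<union> B)"
    using reldim_attained[OF assms(1)] .
  have "span (S \<union> B) \<subseteq> span (S \<union> B')"
    using assms(2) by (intro span_mono) auto
  then show ?thesis using reldim_le[of S Z B'] S by auto
qed

lemma span_Un_finite_part:
  assumes "a \<in> span (T \<union> C)"
  obtains C0 where "finite C0" "C0 \<subseteq> C" "a \<in> span (T \<union> C0)"
proof -
  obtain t r where t: "finite t" "t \<subseteq> T \<union> C" "a = (\<Sum>x\<in>t. scale (r x) x)"
    using assms unfolding span_explicit by blast
  have "a \<in> span (T \<union> (t \<inter> C))"
    unfolding t(3) by (intro span_sum span_scale span_base) (use t in auto)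
  then show thesis using t that[of "t \<inter> C"] by auto
qed

text \<open>The exchange bound concerns finite spanning sets, but \<open>C\<close> may be infinite.
  Only a finite part \<open>C0\<close> of it is needed to express \<open>S\<close>; comparing
  \<open>C0 \<union> S\<close> with \<open>T \<union> C0\<close> and cancelling
  \<open>card C0\<close> gives the bound.\<close>

lemma independent_over_card_le_finite:
  assumes "finite S" "independent (C \<union> S)" "C \<inter> S = {}" "S \<subseteq> span (T \<union> C)" "finite T"
  shows "card S \<le> card T"
proof -
  have "\<forall>s\<in>S. \<exists>C0. finite C0 \<and> C0 \<subseteq> C \<and> s \<in> span (T \<union> C0)"
    using assms(4) span_Un_finite_part by (metis subsetD)
  then obtain f where f: "\<And>s. s \<in> S \<Longrightarrow> finite (f s) \<and> f s \<subseteq> C \<and> s \<in> span (T \<union> f s)"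
    by metis
  define C0 where "C0 = (\<Union>s\<in>S. f s)"
  have C0: "finite C0" "C0 \<subseteq> C" using f assms(1) by (auto simp: C0_def)
  have "S \<subseteq> span (T \<union> C0)"
  proof
    fix s assume "s \<in> S"
    then show "s \<in> span (T \<union> C0)"
      using f[of s] span_mono[of "T \<union> f s" "T \<union> C0"] by (auto simp: C0_def)
  qed
  then have "C0 \<union> S \<subseteq> span (T \<union> C0)" by (auto intro: span_base)
  moreover have "independent (C0 \<union> S)"
    by (rule independent_mono[OF assms(2)]) (use C0 in auto)
  ultimately have "card (C0 \<union> S) \<le> card (T \<union> C0)"
    using independent_span_bound[of "T \<union> C0" "C0 \<union> S"] C0 assms(5) by auto
  moreover have "card (C0 \<union> S) = card C0 + card S"
    using C0 assms by (intro card_Un_disjoint) auto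
  ultimately show ?thesis using card_Un_le[of T C0] by linarith
qed

lemma independent_over_card_le:
  assumes "independent (C \<union> S)" "C \<inter> S = {}" "S \<subseteq> span (T \<union> C)" "finite T"
  shows "finite S \<and> card S \<le> card T"
proof -
  have "finite S"
  proof (rule ccontr)
    assume "infinite S"
    then obtain S0 where S0: "finite S0" "card S0 = Suc (card T)" "S0 \<subseteq> S"
      using infinite_arbitrarily_large by blast
    have "independent (C \<union> S0)"
      by (rule independent_mono[OF assms(1)]) (use S0 in auto)
    then have "card S0 \<le> card T"
      using S0 assms by (intro independent_over_card_le_finite[of S0 C T]) auto
    then show False using S0 by simp
  qed
  then show ?thesis using independent_over_card_le_finite assms by blast
qed

lemma span_Un_cong: "span B = span C \<Longrightarrow> span (S \<union> B) = span (S \<union> C)"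
  by (simp add: span_Un)

text \<open>A smallest generating set \<open>T\<close> also spans \<open>S\<close> modulo
  \<open>C\<close>, so the exchange bound gives \<open>card S \<le> card T\<close>; \<open>S\<close>
  is itself a generating set, which gives the converse.\<close>

lemma reldim_eq_card:
  assumes "independent (C \<union> S)" "C \<inter> S = {}" "span C = span B"
    and "S \<subseteq> Z" "Z \<subseteq> span (C \<union> S)" "relfin Z B"
  shows "finite S \<and> reldim Z B = card S"
proof -
  obtain T where T: "finite T" "T \<subseteq> Z" "card T = reldim Z B" "Z \<subseteq> span (T \<union> B)"
    using reldim_attained[OF assms(6)] by blast
  have "S \<subseteq> span (T \<union> C)"
    using T(4) assms(4) span_Un_cong[OF assms(3), of T] by auto
  then have S: "finite S" "card S \<le> card T"
    using independent_over_card_le[OF assms(1,2)] T(1) by auto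
  moreover have "reldim Z B \<le> card S"
    using S assms(4,5) span_Un_cong[OF assms(3), of S]
    by (intro reldim_le) (auto simp: Un_commute)
  ultimately show ?thesis using T by simp
qed

text \<open>A basis \<open>C\<close> of the span of \<open>B\<close> is extended first by vectors
  \<open>S1\<close> of \<open>Z\<close> and then by vectors \<open>S2\<close> of \<open>Z'\<close>;
  the three dimensions are the sizes of \<open>S1 \<union> S2\<close>, \<open>S1\<close> and
  \<open>S2\<close>.\<close>

lemma reldim_additive:
  assumes "Z \<subseteq> Z'" "relfin Z' B"
  shows "relfin Z B" "reldim Z' B = reldim Z B + reldim Z' (Z \<union> B)"
proof -
  obtain C where C: "C \<subseteq> B" "independent C" "B \<subseteq> span C"
    using maximal_independent_subset[of B] by blast
  have sC: "span C = span B"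
    using C by (metis span_mono span_minimal subspace_span subset_antisym)
  obtain D where D: "C \<subseteq> D" "D \<subseteq> C \<union> Z" "independent D" "C \<union> Z \<subseteq> span D"
    using maximal_independent_subset_extend[of C "C \<union> Z"] C by blast
  define S1 where "S1 = D - C"
  have DS: "D = C \<union> S1" "C \<inter> S1 = {}" "S1 \<subseteq> Z" using D by (auto simp: S1_def)
  obtain E where E: "D \<subseteq> E" "E \<subseteq> D \<union> Z'" "independent E" "D \<union> Z' \<subseteq> span E"
    using maximal_independent_subset_extend[of D "D \<union> Z'"] D by blast
  define S2 where "S2 = E - D"
  have ES: "E = D \<union> S2" "D \<inter> S2 = {}" "S2 \<subseteq> Z'" using E by (auto simp: S2_def)
  have sD: "span D = span (Z \<union> B)"
  proof (rule subset_antisym)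
    show "span D \<subseteq> span (Z \<union> B)" using D C by (intro span_mono) auto
    have "B \<subseteq> span D" using C D span_mono by blast
    then show "span (Z \<union> B) \<subseteq> span D" using D by (intro span_minimal) auto
  qed
  have E12: "E = C \<union> (S1 \<union> S2)" "C \<inter> (S1 \<union> S2) = {}" "S1 \<inter> S2 = {}"
    using DS ES by auto
  have 1: "finite (S1 \<union> S2) \<and> reldim Z' B = card (S1 \<union> S2)"
    using E E12 DS ES assms by (intro reldim_eq_card[OF _ _ sC]) auto
  have "Z \<subseteq> span (S1 \<union> B)"
    using D DS span_Un_cong[OF sC, of S1] by (auto simp: Un_commute)
  then show fin: "relfin Z B"
    using 1 DS unfolding relfin_def by auto
  have 2: "reldim Z B = card S1"
    using D DS fin by (intro conjunct2[OF reldim_eq_card[OF _ _ sC]]) auto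
  have 3: "reldim Z' (Z \<union> B) = card S2"
    using E ES relfin_antimono[OF assms(2), of "Z \<union> B"]
    by (intro conjunct2[OF reldim_eq_card[OF _ _ sD]]) auto
  show "reldim Z' B = reldim Z B + reldim Z' (Z \<union> B)"
    using 1 2 3 E12(3) by (simp add: card_Un_disjoint)
qed

lemma reldim_mono: "Z \<subseteq> Z' \<Longrightarrow> relfin Z' B \<Longrightarrow> reldim Z B \<le> reldim Z' B"
  using reldim_additive by simp

text \<open>By additivity the gain from \<open>Z\<close> to \<open>Z'\<close> is the dimension of
  \<open>Z'\<close> modulo Z + B, which can only drop when \<open>B\<close> grows. All inequalities
  between bar counts below come from this one.\<close>

lemma reldim_modular:
  assumes "Z \<subseteq> Z'" "B \<subseteq> B'" "relfin Z' B"
  shows "reldim Z B + reldim Z' B' \<le> reldim Z' B + reldim Z B'"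
proof -
  have "reldim Z' (Z \<union> B') \<le> reldim Z' (Z \<union> B)"
    using assms by (intro reldim_antimono relfin_antimono[OF assms(3)]) auto
  then show ?thesis
    using reldim_additive[OF assms(1,3)]
      reldim_additive[OF assms(1) relfin_antimono[OF assms(3,2)]] by simp
qed

end

section \<open>Rank functions and their index sets\<close>

text \<open>The set \<open>I\<close> is the interval from \<open>lim\<^sub>s lim\<^sub>e Q\<close> to \<open>lim P\<close>. Its length is already attained on
  the diagonal \<open>e = s\<close>, because \<open>P - Q\<close> is monotone in both arguments.\<close>

lemma limit_index_set:
  fixes P Q :: "real \<Rightarrow> real \<Rightarrow> nat" and ok :: "real \<Rightarrow> real \<Rightarrow> bool"
  assumes ok_ex: "ok e0 s0"
    and ok_pos: "\<And>e s. ok e s \<Longrightarrow> 0 < e \<and> 0 < s"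
    and ok_down: "\<And>e s e' s'. ok e s \<Longrightarrow> 0 < e' \<Longrightarrow> e' \<le> e \<Longrightarrow> 0 < s' \<Longrightarrow> s' \<le> s \<Longrightarrow> ok e' s'"
    and P: "\<And>e s e' s'. ok e s \<Longrightarrow> 0 < e' \<Longrightarrow> e' \<le> e \<Longrightarrow> 0 < s' \<Longrightarrow> s' \<le> s \<Longrightarrow> P e' s' \<le> P e s"
    and Qe: "\<And>e s e'. ok e s \<Longrightarrow> 0 < e' \<Longrightarrow> e' \<le> e \<Longrightarrow> Q e' s \<le> Q e s"
    and Qs: "\<And>e s s'. ok e s \<Longrightarrow> 0 < s' \<Longrightarrow> s' \<le> s \<Longrightarrow> Q e s \<le> Q e s'"
    and QP: "\<And>e s. ok e s \<Longrightarrow> Q e s \<le> P e s"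
    and box: "\<And>e s e' s'. ok e s \<Longrightarrow> 0 < e' \<Longrightarrow> e' \<le> e \<Longrightarrow> 0 < s' \<Longrightarrow> s' \<le> s \<Longrightarrow>
      P e' s' - Q e' s' \<le> P e s - Q e s"
  defines "I \<equiv> {i. (\<forall>e s. ok e s \<longrightarrow> i < P e s) \<and> (\<forall>s. (\<exists>e. ok e s) \<longrightarrow> (\<exists>e. ok e s \<and> Q e s \<le> i))}"
  shows "finite I" "int (card I) = Inf {int (P e e) - int (Q e e) | e. ok e e}"
proof -
  \<comment> \<open>Values are natural numbers, so \<open>P\<close> attains a minimum; by
    monotonicity it is constant below that point.\<close>
  have "\<exists>x. (case x of (e, s) \<Rightarrow> ok e s) \<and>
      (\<forall>y. (case y of (e, s) \<Rightarrow> ok e s) \<longrightarrow> case_prod P x \<le> case_prod P y)"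
    by (rule ex_has_least_nat[of _ "(e0, s0)"]) (use ok_ex in simp)
  then obtain e1 s1 where 1: "ok e1 s1" "\<And>e s. ok e s \<Longrightarrow> P e1 s1 \<le> P e s" by auto
  define p where "p = P e1 s1"
  have Pp: "P e s = p" if "0 < e" "e \<le> e1" "0 < s" "s \<le> s1" for e s
    unfolding p_def using 1 P ok_down that by (meson le_antisym)
  \<comment> \<open>The inner limit of \<open>Q e s\<close> as e tends to 0. The order of the limits
    matters: \<open>Q\<close> falls as e shrinks but rises as s shrinks, so it need not be monotone
    along e = s.\<close>
  define q where "q s = (LEAST m. \<exists>e. ok e s \<and> Q e s = m)" for s
  have q_att: "\<exists>e. ok e s \<and> Q e s = q s" if "ok e s" for e s
    unfolding q_def using LeastI_ex[of "\<lambda>m. \<exists>e. ok e s \<and> Q e s = m"] that by blast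
  have q_le: "q s \<le> Q e s" if "ok e s" for e s
    unfolding q_def using that by (intro Least_le) blast
  have q_p: "q s \<le> P e s'" if "ok e s'" "ok e' s" for s e s' e'
  proof -
    from q_att[OF that(2)] obtain e'' where e'': "ok e'' s" "Q e'' s = q s" by blast
    let ?e = "min e e''" and ?s = "min s s'"
    have pos: "0 < ?e" "0 < ?s" using ok_pos[OF that(1)] ok_pos[OF e''(1)] by auto
    have ok: "ok ?e s" "ok ?e ?s" "ok ?e s'"
      using pos ok_pos[OF that(1)] ok_pos[OF e''(1)] by (auto intro: ok_down[OF e''(1)] ok_down[OF that(1)])
    have "q s \<le> Q ?e s" using q_le ok by blast
    also have "\<dots> \<le> Q ?e ?s" using ok pos by (intro Qs) auto
    also have "\<dots> \<le> P ?e ?s" using ok by (intro QP)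
    also have "\<dots> \<le> P e s'" using pos that by (intro P) auto
    finally show ?thesis .
  qed
  have q_anti: "q s \<le> q s'" if "ok e s" "0 < s'" "s' \<le> s" for e s s'
  proof -
    have "ok e s'" using that ok_pos[OF that(1)] by (auto intro: ok_down[OF that(1)])
    then obtain e' where e': "ok e' s'" "Q e' s' = q s'" using q_att[of e s'] by blast
    let ?e = "min e e'"
    have pos: "0 < ?e" using ok_pos[OF that(1)] ok_pos[OF e'(1)] by auto
    have ok: "ok ?e s" using pos that ok_pos[OF that(1)] by (auto intro: ok_down[OF that(1)])
    have "q s \<le> Q ?e s" using q_le ok by blast
    also have "\<dots> \<le> Q ?e s'" using ok that by (intro Qs) auto
    also have "\<dots> \<le> Q e' s'" using e' pos by (intro Qe) auto
    finally show ?thesis using e' by simp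
  qed
  \<comment> \<open>\<open>q\<close> rises as s shrinks and is bounded by \<open>p\<close>, so its
    limit is attained, at \<open>s2\<close>.\<close>
  have "\<exists>s. (\<exists>e. ok e s) \<and> (\<forall>s'. (\<exists>e. ok e s') \<longrightarrow> q s' \<le> q s)"
    using ok_ex 1(1) q_p[OF 1(1)] by (intro ex_has_greatest_nat[of _ s0 _ "Suc p"]) (auto simp: p_def less_Suc_eq_le)
  then obtain s2 e2 where 2: "ok e2 s2" "\<And>e s. ok e s \<Longrightarrow> q s \<le> q s2" by auto
  have I: "I = {q s2..<p}"
  proof (intro set_eqI iffI)
    fix i assume i: "i \<in> I"
    then have "i < p" using 1(1) by (auto simp: I_def p_def)
    moreover obtain e where "ok e s2" "Q e s2 \<le> i" using i 2(1) unfolding I_def by blast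
    then have "q s2 \<le> i" using q_le le_trans by blast
    ultimately show "i \<in> {q s2..<p}" by simp
  next
    fix i assume i: "i \<in> {q s2..<p}"
    have "i < P e s" if "ok e s" for e s using 1(2)[OF that] i by (simp add: p_def)
    moreover have "\<exists>e. ok e s \<and> Q e s \<le> i" if "ok e' s" for e' s
      using q_att[OF that] 2(2)[OF that] i by auto
    ultimately show "i \<in> I" unfolding I_def by blast
  qed
  show "finite I" by (simp add: I)
  \<comment> \<open>The limiting value occurs for every small s, but how small e must be depends on
    s. The diagonal is reached only through the monotonicity of P - Q.\<close>
  have lim: "\<exists>e'. ok e' s \<and> e' \<le> e \<and> P e' s - Q e' s = p - q s2"
    if "ok e s" "s \<le> s1" "s \<le> s2" for e s
  proof -
    have s: "0 < s" using ok_pos that by blast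
    from q_att[OF that(1)] obtain e' where e': "ok e' s" "Q e' s = q s" by blast
    let ?e = "min e (min e1 e')"
    have e: "0 < ?e" using ok_pos[OF e'(1)] ok_pos[OF 1(1)] ok_pos[OF that(1)] by auto
    have ok: "ok ?e s" using e s by (intro ok_down[OF that(1)]) auto
    have "q s = q s2" using q_anti[OF 2(1) s that(3)] 2(2)[OF that(1)] by simp
    moreover have "Q ?e s \<le> q s" using Qe[OF e'(1) e] e'(2) by simp
    moreover have "q s \<le> Q ?e s" using q_le[OF ok] .
    ultimately have "Q ?e s = q s2" by simp
    moreover have "P ?e s = p" using e s that by (intro Pp) auto
    ultimately show ?thesis using ok by (intro exI[of _ ?e]) auto
  qed
  have lower: "p - q s2 \<le> P e e - Q e e" if "ok e e" for e
  proof -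
    let ?s = "min e (min s1 s2)"
    have pos: "0 < ?s" "0 < e" using ok_pos[OF that] ok_pos[OF 1(1)] ok_pos[OF 2(1)] by auto
    have "ok e ?s" using pos by (intro ok_down[OF that]) auto
    then obtain e' where e': "ok e' ?s" "e' \<le> e" "P e' ?s - Q e' ?s = p - q s2"
      using lim[of e ?s] by (metis min.cobounded1 min.cobounded2 min.coboundedI2)
    show ?thesis using box[OF that, of e' ?s] e' ok_pos[OF e'(1)] by auto
  qed
  \<comment> \<open>Shrinking a rectangle with the limiting value to a square cannot increase P - Q,
    and \<open>lower\<close> forbids a decrease.\<close>
  have "\<exists>e. ok e e \<and> P e e - Q e e = p - q s2"
  proof -
    let ?s = "min s1 s2"
    have pos: "0 < ?s" using ok_pos[OF 1(1)] ok_pos[OF 2(1)] by auto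
    have "ok e2 ?s" using pos ok_pos[OF 2(1)] by (intro ok_down[OF 2(1)]) auto
    then obtain e where e: "ok e ?s" "P e ?s - Q e ?s = p - q s2"
      using lim[of e2 ?s] by (metis min.cobounded1 min.cobounded2)
    let ?e = "min e ?s"
    have pe: "0 < ?e" using pos ok_pos[OF e(1)] by auto
    have ok: "ok ?e ?e" using pe by (intro ok_down[OF e(1)]) auto
    have "P ?e ?e - Q ?e ?e \<le> p - q s2" using box[OF e(1) pe min.cobounded1 pe min.cobounded2] e(2) by simp
    then show ?thesis using lower[OF ok] ok by (intro exI[of _ ?e]) auto
  qed
  then obtain e where e: "ok e e" "P e e - Q e e = p - q s2" by blast
  have "Inf {int (P e e) - int (Q e e) | e. ok e e} = int (p - q s2)"
  proof (rule cInf_eq_minimum)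
    show "int (p - q s2) \<in> {int (P e e) - int (Q e e) | e. ok e e}"
      using e QP[OF e(1)] by (intro CollectI exI[of _ e]) (auto simp: of_nat_diff)
  next
    fix x assume "x \<in> {int (P e e) - int (Q e e) | e. ok e e}"
    then obtain e where "ok e e" "x = int (P e e) - int (Q e e)" by auto
    then show "int (p - q s2) \<le> x" using lower[of e] QP[of e e] by (simp add: of_nat_diff)
  qed
  then show "int (card I) = Inf {int (P e e) - int (Q e e) | e. ok e e}" by (simp add: I)
qed

text \<open>A rank function defined only for \<open>u + c < v\<close>. The predicate \<open>L u i x\<close> says that the
  barcode has more than \<open>i\<close> bars born exactly at \<open>u\<close> and alive at \<open>x\<close>; \<open>R w i x\<close> says that it has
  more than \<open>i\<close> bars born no later than \<open>x\<close> and dying exactly at \<open>w\<close>. Hence \<open>idxL u w i\<close> numbers the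
  bars \<open>(u, w)\<close> among all bars born at \<open>u\<close>, by decreasing death, and \<open>idxR u w i\<close> numbers them among
  all bars dying at \<open>w\<close>, by increasing birth.\<close>

locale rank_region =
  fixes \<rho> :: "real \<Rightarrow> real \<Rightarrow> nat" and c :: real
  assumes mono: "\<And>u u' v. u \<le> u' \<Longrightarrow> u' + c < v \<Longrightarrow> \<rho> u v \<le> \<rho> u' v"
    and anti: "\<And>u v v'. u + c < v \<Longrightarrow> v \<le> v' \<Longrightarrow> \<rho> u v' \<le> \<rho> u v"
    and box: "\<And>u u' v v'. u \<le> u' \<Longrightarrow> u' + c < v \<Longrightarrow> v \<le> v' \<Longrightarrow> \<rho> u v + \<rho> u' v' \<le> \<rho> u' v + \<rho> u v'"
    and low: "\<exists>a. \<forall>u<a. \<forall>v. u + c < v \<longrightarrow> \<rho> u v = 0"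
begin

definition L :: "real \<Rightarrow> nat \<Rightarrow> real \<Rightarrow> bool" where
  "L u i x \<longleftrightarrow> (\<forall>e>0. u + e + c < x \<longrightarrow> i < \<rho> (u + e) x - \<rho> (u - e) x)"

definition R :: "ereal \<Rightarrow> nat \<Rightarrow> real \<Rightarrow> bool" where
  "R w i x \<longleftrightarrow> (if w = \<infinity> then \<forall>v. x + c < v \<longrightarrow> i < \<rho> x v
     else \<forall>s>0. x + c < real_of_ereal w - s \<longrightarrow>
       i < \<rho> x (real_of_ereal w - s) - \<rho> x (real_of_ereal w + s))"

definition idxL :: "real \<Rightarrow> ereal \<Rightarrow> nat \<Rightarrow> bool" where
  "idxL u w i \<longleftrightarrow> ereal (u + c) < w \<and> (\<forall>x. u + c < x \<longrightarrow> ereal x < w \<longrightarrow> L u i x)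
     \<and> (\<forall>x. w < ereal x \<longrightarrow> \<not> L u i x)"

definition idxR :: "real \<Rightarrow> ereal \<Rightarrow> nat \<Rightarrow> bool" where
  "idxR u w i \<longleftrightarrow> ereal (u + c) < w \<and> (\<forall>x>u. ereal (x + c) < w \<longrightarrow> R w i x)
     \<and> (\<forall>x<u. \<not> R w i x)"

text \<open>The difference counts the bars born after u, no later than u', and alive at v; fewer of
  them survive to a later v'. In \<open>row_diff\<close> the roles of birth and death are
  exchanged.\<close>

lemma col_diff:
  "u \<le> u' \<Longrightarrow> u' + c < v \<Longrightarrow> v \<le> v' \<Longrightarrow> \<rho> u' v' - \<rho> u v' \<le> \<rho> u' v - \<rho> u v"
  using box[of u u' v v'] by linarith

lemma row_diff:
  "u \<le> u' \<Longrightarrow> u' + c < v \<Longrightarrow> v \<le> v' \<Longrightarrow> \<rho> u v - \<rho> u v' \<le> \<rho> u' v - \<rho> u' v'"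
  using box[of u u' v v'] by linarith

lemma col_diff_mono:
  "a' \<le> a \<Longrightarrow> a \<le> b \<Longrightarrow> b \<le> b' \<Longrightarrow> b' + c < v \<Longrightarrow> \<rho> b v - \<rho> a v \<le> \<rho> b' v - \<rho> a' v"
  by (intro diff_le_mono2 order_trans[OF diff_le_mono diff_le_mono2] mono) auto

lemma row_diff_mono:
  "a' \<le> a \<Longrightarrow> a \<le> b \<Longrightarrow> b \<le> b' \<Longrightarrow> u + c < a' \<Longrightarrow> \<rho> u a - \<rho> u b \<le> \<rho> u a' - \<rho> u b'"
  by (intro order_trans[OF diff_le_mono diff_le_mono2] anti) auto

lemma L_antimono:
  assumes "L u i y" "u + c < x" "x \<le> y"
  shows "L u i x"
  unfolding L_def
proof (intro allI impI)
  fix e :: real assume e: "0 < e" "u + e + c < x"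
  have "i < \<rho> (u + e) y - \<rho> (u - e) y" using assms e unfolding L_def by auto
  also have "\<dots> \<le> \<rho> (u + e) x - \<rho> (u - e) x" using assms e by (intro col_diff) auto
  finally show "i < \<rho> (u + e) x - \<rho> (u - e) x" .
qed

lemma R_mono:
  assumes "R w i x" "x \<le> y" "ereal (y + c) < w"
  shows "R w i y"
proof (cases w)
  case (real r)
  have "i < \<rho> y (r - s) - \<rho> y (r + s)" if s: "0 < s" "y + c < r - s" for s
  proof -
    have "i < \<rho> x (r - s) - \<rho> x (r + s)" using assms s real unfolding R_def by auto
    also have "\<dots> \<le> \<rho> y (r - s) - \<rho> y (r + s)" using assms s by (intro row_diff) auto
    finally show ?thesis .
  qed
  then show ?thesis using real by (auto simp: R_def)
next
  case PInf
  have "i < \<rho> y v" if "y + c < v" for v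
  proof -
    have "i < \<rho> x v" using assms that PInf unfolding R_def by auto
    also have "\<dots> \<le> \<rho> y v" using assms that by (intro mono) auto
    finally show ?thesis .
  qed
  then show ?thesis using PInf by (auto simp: R_def)
qed (use assms in auto)

section \<open>Existence and uniqueness of the death, respectively birth, with a given
  number\<close>

lemma idxL_unique:
  assumes "idxL u w i" "idxL u w' i"
  shows "w = w'"
proof -
  have False if "idxL u w i" "idxL u w' i" "w < w'" for w w'
  proof -
    from ereal_dense2[OF that(3)] obtain x where "w < ereal x" "ereal x < w'" by blast
    moreover have "ereal (u + c) < ereal x"
      using that(1) calculation(1) unfolding idxL_def by (metis less_trans)
    ultimately show False using that unfolding idxL_def by auto
  qed
  then show ?thesis using assms by (meson linorder_less_linear)
qed

text \<open>\<open>L u i\<close> is downward closed above \<open>u + c\<close>, so the supremum of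
  the levels where it holds is the death of bar number i. Nothing is demanded at this level itself,
  where the ranks may jump. The supremum may be \<infinity>.\<close>

lemma idxL_ex:
  assumes "u + c < x" "L u i x"
  obtains w where "idxL u w i" "ereal x \<le> w"
proof -
  define w where "w = Sup (ereal ` {x. u + c < x \<and> L u i x})"
  have x: "ereal x \<le> w" unfolding w_def using assms by (intro Sup_upper) auto
  have "ereal (u + c) < w" using assms(1) x by (meson ereal_less_eq(3) less_le_trans less_ereal.simps(1))
  moreover have "L u i y" if y: "u + c < y" "ereal y < w" for y
  proof -
    obtain z where "u + c < z" "L u i z" "y < z" using y(2) unfolding w_def less_Sup_iff by auto
    then show ?thesis using L_antimono y by (meson less_imp_le)
  qed
  moreover have "\<not> L u i y" if y: "w < ereal y" for y
  proof
    assume "L u i y"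
    moreover have "ereal (u + c) < ereal y" using \<open>ereal (u + c) < w\<close> y by (rule less_trans)
    ultimately have "ereal y \<le> w" unfolding w_def by (intro Sup_upper) auto
    then show False using y by simp
  qed
  ultimately have "idxL u w i" unfolding idxL_def by blast
  then show thesis using x that by blast
qed

lemma R_room:
  assumes "ereal (x + c) < w" "R w i x"
  obtains v where "x + c < v" "i < \<rho> x v"
proof (cases w)
  case (real r)
  let ?s = "(r - x - c) / 2"
  have "0 < ?s" "x + c < r - ?s" using assms(1) real by (auto simp: field_simps)
  then have "i < \<rho> x (r - ?s) - \<rho> x (r + ?s)" using assms(2) real unfolding R_def by auto
  then have "i < \<rho> x (r - ?s)" by linarith
  then show thesis using that \<open>x + c < r - ?s\<close> by blast
next
  case PInf
  then show thesis using assms(2) that[of "x + c + 1"] unfolding R_def by auto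
qed (use assms in auto)

text \<open>The birth is the infimum of the levels satisfying \<open>R w i\<close>. It must be a
  real number: by \<open>R_room\<close> each such level carries a positive rank, and
  \<open>low\<close> excludes this far to the left.\<close>

lemma idxR_ex:
  assumes "ereal (x + c) < w" "R w i x"
  obtains u where "idxR u w i" "u \<le> x"
proof -
  obtain a where a: "\<And>u v. u < a \<Longrightarrow> u + c < v \<Longrightarrow> \<rho> u v = 0" using low by blast
  define S where "S = {x. ereal (x + c) < w \<and> R w i x}"
  have lb: "a \<le> y" if "y \<in> S" for y
  proof (rule ccontr)
    assume "\<not> a \<le> y"
    then show False using R_room[of y w i] a[of y] that unfolding S_def by force
  qed
  then have bdd: "bdd_below S" by (rule bdd_belowI)
  have x: "x \<in> S" using assms by (simp add: S_def)
  define u where "u = Inf S"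
  have ux: "u \<le> x" unfolding u_def using bdd x by (rule cInf_lower[rotated])
  have "ereal (u + c) \<le> ereal (x + c)" using ux by simp
  then have uw: "ereal (u + c) < w" using assms(1) by (rule le_less_trans)
  moreover have "R w i y" if y: "u < y" "ereal (y + c) < w" for y
  proof -
    have "S \<noteq> {}" using x by blast
    then obtain z where "z \<in> S" "z < y" using y(1) cInf_less_iff[OF _ bdd] unfolding u_def by blast
    then show ?thesis using R_mono[of w i z y] y(2) by (auto simp: S_def)
  qed
  moreover have "\<not> R w i y" if y: "y < u" for y
  proof
    assume "R w i y"
    moreover have "ereal (y + c) < ereal (u + c)" using y by simp
    then have "ereal (y + c) < w" using uw by (rule less_trans)
    ultimately have "u \<le> y" unfolding u_def using bdd by (intro cInf_lower) (auto simp: S_def)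
    then show False using y by simp
  qed
  ultimately have "idxR u w i" unfolding idxR_def by blast
  then show thesis using ux that by blast
qed

lemma idxR_unique:
  assumes "idxR u w i" "idxR u' w i"
  shows "u = u'"
proof -
  have False if a: "idxR u w i" "idxR u' w i" "u < u'" for u u'
  proof -
    obtain x where x: "u < x" "x < u'" using a(3) dense by blast
    then have "ereal (x + c) < ereal (u' + c)" by simp
    then have "ereal (x + c) < w" using a(2) unfolding idxR_def by (meson less_trans)
    then show False using a x unfolding idxR_def by auto
  qed
  then show ?thesis using assms by (meson linorder_less_linear)
qed

section \<open>Index counts as multiplicities of cornerpoints\<close>

lemma rectangle_mono:
  assumes "a' \<le> a" "a \<le> b" "b \<le> b'" "v' \<le> v" "v \<le> w" "w \<le> w'" "b' + c < v'"
  shows "(\<rho> b v - \<rho> a v) - (\<rho> b w - \<rho> a w) \<le> (\<rho> b' v' - \<rho> a' v') - (\<rho> b' w' - \<rho> a' w')"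
    and "(\<rho> b v - \<rho> b w) - (\<rho> a v - \<rho> a w) \<le> (\<rho> b' v' - \<rho> b' w') - (\<rho> a' v' - \<rho> a' w')"
proof -
  \<comment> \<open>The large rectangle minus the small one is cut into four: the strips left and
    right of it at full height, and the pieces below and above it. Each contributes a nonnegative
    count.\<close>
  have boxes: "\<rho> a' v' + \<rho> a w' \<le> \<rho> a v' + \<rho> a' w'" "\<rho> b v' + \<rho> b' w' \<le> \<rho> b' v' + \<rho> b w'"
    "\<rho> a v' + \<rho> b v \<le> \<rho> b v' + \<rho> a v" "\<rho> a w + \<rho> b w' \<le> \<rho> b w + \<rho> a w'"
    using assms by (auto intro!: box)
  have mns: "\<rho> a v \<le> \<rho> b v" "\<rho> a w \<le> \<rho> b w" "\<rho> a' v' \<le> \<rho> b' v'" "\<rho> a' w' \<le> \<rho> b' w'"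
    using assms by (auto intro!: mono)
  have antis: "\<rho> b w \<le> \<rho> b v" "\<rho> a w \<le> \<rho> a v" "\<rho> b' w' \<le> \<rho> b' v'" "\<rho> a' w' \<le> \<rho> a' v'"
    using assms by (auto intro!: anti)
  show "(\<rho> b v - \<rho> a v) - (\<rho> b w - \<rho> a w) \<le> (\<rho> b' v' - \<rho> a' v') - (\<rho> b' w' - \<rho> a' w')"
    using boxes mns antis by linarith
  show "(\<rho> b v - \<rho> b w) - (\<rho> a v - \<rho> a w) \<le> (\<rho> b' v' - \<rho> b' w') - (\<rho> a' v' - \<rho> a' w')"
    using boxes mns antis by linarith
qed

text \<open>For c = 0 this is the integer under \<open>nat\<close> in \<open>mult_proper\<close>,
  and \<open>strip_infimum\<close> the one in \<open>mult_inf\<close>. They are the common value to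
  which both numberings are compared.\<close>

definition box_infimum :: "real \<Rightarrow> real \<Rightarrow> int" where
  "box_infimum u r = Inf {int (\<rho> (u + e) (r - e)) - int (\<rho> (u - e) (r - e))
     - int (\<rho> (u + e) (r + e)) + int (\<rho> (u - e) (r + e)) | e. 0 < e \<and> u + e + c < r - e}"

definition strip_infimum :: "real \<Rightarrow> int" where
  "strip_infimum u = Inf {int (\<rho> (u + e) (1 / e)) - int (\<rho> (u - e) (1 / e)) | e. 0 < e \<and> u + e + c < 1 / e}"

text \<open>\<open>P e s\<close> and \<open>Q e s\<close> count the bars born within e of u that are
  alive just before, respectively just after, r. The numbers of the bars (u, r) fill the gap between
  the limits of \<open>Q\<close> and \<open>P\<close>.\<close>

lemma idxL_finite_index:
  assumes "u + c < r"
  shows "finite {i. idxL u (ereal r) i}" "int (card {i. idxL u (ereal r) i}) = box_infimum u r"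
proof -
  define ok where "ok e s \<longleftrightarrow> 0 < e \<and> 0 < s \<and> u + e + c < r - s" for e s
  define P where "P e s = \<rho> (u + e) (r - s) - \<rho> (u - e) (r - s)" for e s
  define Q where "Q e s = \<rho> (u + e) (r + s) - \<rho> (u - e) (r + s)" for e s
  have ok_ex: "ok ((r - u - c) / 3) ((r - u - c) / 3)" using assms by (auto simp: ok_def field_simps)
  have down: "ok e' s'" if "ok e s" "0 < e'" "e' \<le> e" "0 < s'" "s' \<le> s" for e s e' s'
    using that by (auto simp: ok_def)
  have Q_mono: "Q e' s \<le> Q e s" if "ok e s" "0 < e'" "e' \<le> e" for e s e'
    using that unfolding ok_def Q_def by (intro col_diff_mono) auto
  have Q_anti: "Q e s \<le> Q e s'" if "ok e s" "0 < s'" "s' \<le> s" for e s s'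
    using that unfolding ok_def Q_def by (intro col_diff) auto
  have pos: "0 < e \<and> 0 < s" if "ok e s" for e s using that by (simp add: ok_def)
  have P_mono: "P e' s' \<le> P e s"
    if a: "ok e s" "0 < e'" "e' \<le> e" "0 < s'" "s' \<le> s" for e s e' s'
  proof -
    have "P e' s' \<le> P e s'" using a unfolding P_def ok_def by (intro col_diff_mono) auto
    also have "\<dots> \<le> P e s" using a unfolding P_def ok_def by (intro col_diff) auto
    finally show ?thesis .
  qed
  have QP: "Q e s \<le> P e s" if "ok e s" for e s
    using that unfolding P_def Q_def ok_def by (intro col_diff) auto
  have rect: "P e' s' - Q e' s' \<le> P e s - Q e s"
    if "ok e s" "0 < e'" "e' \<le> e" "0 < s'" "s' \<le> s" for e s e' s'
    using that unfolding P_def Q_def ok_def by (intro rectangle_mono) auto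
  define I where "I = {i. (\<forall>e s. ok e s \<longrightarrow> i < P e s) \<and>
    (\<forall>s. (\<exists>e. ok e s) \<longrightarrow> (\<exists>e. ok e s \<and> Q e s \<le> i))}"
  have *: "finite I" "int (card I) = Inf {int (P e e) - int (Q e e) | e. ok e e}"
    unfolding I_def
    by (rule limit_index_set[where ok = ok and P = P and Q = Q], rule ok_ex, fact pos, fact down,
        fact P_mono, fact Q_mono, fact Q_anti, fact QP, fact rect)+
  have P_iff: "(\<forall>x. u + c < x \<longrightarrow> ereal x < ereal r \<longrightarrow> L u i x) \<longleftrightarrow> (\<forall>e s. ok e s \<longrightarrow> i < P e s)" for i
  proof (intro iffI allI impI)
    fix e s assume "\<forall>x. u + c < x \<longrightarrow> ereal x < ereal r \<longrightarrow> L u i x" "ok e s"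
    then have "L u i (r - s)" "0 < e" "u + e + c < r - s" by (auto simp: ok_def)
    then show "i < P e s" unfolding P_def L_def by blast
  next
    fix x assume a: "\<forall>e s. ok e s \<longrightarrow> i < P e s" "u + c < x" "ereal x < ereal r"
    show "L u i x" unfolding L_def
    proof (intro allI impI)
      fix e :: real assume "0 < e" "u + e + c < x"
      then show "i < \<rho> (u + e) x - \<rho> (u - e) x"
        using a(1)[rule_format, of e "r - x"] a(3) by (auto simp: ok_def P_def)
    qed
  qed
  have Q_iff: "(\<forall>x. ereal r < ereal x \<longrightarrow> \<not> L u i x) \<longleftrightarrow>
      (\<forall>s. (\<exists>e. ok e s) \<longrightarrow> (\<exists>e. ok e s \<and> Q e s \<le> i))" for i
  proof (intro iffI allI impI)
    fix s assume a: "\<forall>x. ereal r < ereal x \<longrightarrow> \<not> L u i x" "\<exists>e. ok e s"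
    then obtain e0 where e0: "ok e0 s" by blast
    then have "\<not> L u i (r + s)" using a(1) by (auto simp: ok_def)
    then obtain e where e: "0 < e" "u + e + c < r + s" "Q e s \<le> i"
      unfolding L_def Q_def by (auto simp: not_less)
    have "Q (min e e0) s \<le> Q e s"
      using e e0 unfolding Q_def ok_def by (intro col_diff_mono) auto
    moreover have "ok (min e e0) s" using e e0 by (auto simp: ok_def)
    ultimately show "\<exists>e. ok e s \<and> Q e s \<le> i" using e(3) by (meson le_trans)
  next
    fix x assume a: "\<forall>s. (\<exists>e. ok e s) \<longrightarrow> (\<exists>e. ok e s \<and> Q e s \<le> i)" "ereal r < ereal x"
    \<comment> \<open>The level x may be far above r, while an admissible pair needs s below the
      available room; the cap by a third of the room leaves space for e.\<close>
    define s where "s = min (x - r) ((r - u - c) / 3)"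
    have s_le: "s \<le> x - r" by (simp add: s_def)
    have "ok ((r - u - c) / 3) s" using a(2) assms unfolding s_def by (intro down[OF ok_ex] min.cobounded2) auto
    then obtain e where e: "ok e s" "Q e s \<le> i" using a(1) by blast
    have "\<rho> (u + e) x - \<rho> (u - e) x \<le> Q e s"
      using e(1) s_le unfolding ok_def Q_def by (intro col_diff) auto
    then have "\<not> i < \<rho> (u + e) x - \<rho> (u - e) x" using e(2) by simp
    then show "\<not> L u i x" using e(1) a(2) unfolding L_def ok_def by force
  qed
  have **: "{i. idxL u (ereal r) i} = I"
    unfolding I_def idxL_def P_iff Q_iff using assms by simp
  have "int (P e e) - int (Q e e) = int (\<rho> (u + e) (r - e)) - int (\<rho> (u - e) (r - e))
     - int (\<rho> (u + e) (r + e)) + int (\<rho> (u - e) (r + e))" if "ok e e" for e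
    using that mono[of "u - e" "u + e" "r - e"] mono[of "u - e" "u + e" "r + e"]
    unfolding P_def Q_def ok_def by (simp add: of_nat_diff)
  then have "{int (P e e) - int (Q e e) | e. ok e e} = {int (\<rho> (u + e) (r - e)) - int (\<rho> (u - e) (r - e))
     - int (\<rho> (u + e) (r + e)) + int (\<rho> (u - e) (r + e)) | e. ok e e}"
    by (intro Collect_cong) metis
  then show "finite {i. idxL u (ereal r) i}" "int (card {i. idxL u (ereal r) i}) = box_infimum u r"
    using * unfolding ** box_infimum_def by (simp_all add: ok_def)
qed

text \<open>The transposed argument: s now plays the part of e in \<open>limit_index_set\<close>.
  \<open>P\<close> and \<open>Q\<close> count the bars dying within s of r that are born by u + e,
  respectively by u - e.\<close>

lemma idxR_finite_index:
  assumes "u + c < r"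
  shows "finite {i. idxR u (ereal r) i}" "int (card {i. idxR u (ereal r) i}) = box_infimum u r"
proof -
  define ok where "ok s e \<longleftrightarrow> 0 < s \<and> 0 < e \<and> u + e + c < r - s" for e s
  define P where "P s e = \<rho> (u + e) (r - s) - \<rho> (u + e) (r + s)" for e s
  define Q where "Q s e = \<rho> (u - e) (r - s) - \<rho> (u - e) (r + s)" for e s
  have ok_ex: "ok ((r - u - c) / 3) ((r - u - c) / 3)" using assms by (auto simp: ok_def field_simps)
  have down: "ok e' s'" if "ok e s" "0 < e'" "e' \<le> e" "0 < s'" "s' \<le> s" for e s e' s'
    using that by (auto simp: ok_def)
  have Q_mono: "Q s' e \<le> Q s e" if "ok s e" "0 < s'" "s' \<le> s" for e s s'
    using that unfolding ok_def Q_def by (intro row_diff_mono) auto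
  have Q_anti: "Q s e \<le> Q s e'" if "ok s e" "0 < e'" "e' \<le> e" for e s e'
    using that unfolding ok_def Q_def by (intro row_diff) auto
  have pos: "0 < s \<and> 0 < e" if "ok s e" for s e using that by (simp add: ok_def)
  have P_mono: "P s' e' \<le> P s e"
    if a: "ok s e" "0 < s'" "s' \<le> s" "0 < e'" "e' \<le> e" for s e s' e'
  proof -
    have "P s' e' \<le> P s e'" using a unfolding P_def ok_def by (intro row_diff_mono) auto
    also have "\<dots> \<le> P s e" using a unfolding P_def ok_def by (intro row_diff) auto
    finally show ?thesis .
  qed
  have QP: "Q s e \<le> P s e" if "ok s e" for s e
    using that unfolding P_def Q_def ok_def by (intro row_diff) auto
  have rect: "P s' e' - Q s' e' \<le> P s e - Q s e"
    if "ok s e" "0 < s'" "s' \<le> s" "0 < e'" "e' \<le> e" for s e s' e'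
    using that unfolding P_def Q_def ok_def by (intro rectangle_mono) auto
  define I where "I = {i. (\<forall>s e. ok s e \<longrightarrow> i < P s e) \<and>
    (\<forall>e. (\<exists>s. ok s e) \<longrightarrow> (\<exists>s. ok s e \<and> Q s e \<le> i))}"
  have *: "finite I" "int (card I) = Inf {int (P e e) - int (Q e e) | e. ok e e}"
    unfolding I_def
    by (rule limit_index_set[where ok = ok and P = P and Q = Q], rule ok_ex, fact pos, fact down,
        fact P_mono, fact Q_mono, fact Q_anti, fact QP, fact rect)+
  have P_iff: "(\<forall>x>u. ereal (x + c) < ereal r \<longrightarrow> R (ereal r) i x) \<longleftrightarrow> (\<forall>s e. ok s e \<longrightarrow> i < P s e)" for i
  proof (intro iffI allI impI)
    fix e s assume "\<forall>x>u. ereal (x + c) < ereal r \<longrightarrow> R (ereal r) i x" "ok s e"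
    then have "R (ereal r) i (u + e)" "0 < s" "u + e + c < r - s" by (auto simp: ok_def)
    then show "i < P s e" unfolding P_def R_def by auto
  next
    fix x assume a: "\<forall>s e. ok s e \<longrightarrow> i < P s e" "u < x" "ereal (x + c) < ereal r"
    show "R (ereal r) i x" unfolding R_def
    proof (simp, intro allI impI)
      fix s :: real assume "0 < s" "x + c < r - s"
      then show "i < \<rho> x (r - s) - \<rho> x (r + s)"
        using a(1)[rule_format, of s "x - u"] a(2) by (auto simp: ok_def P_def)
    qed
  qed
  have Q_iff: "(\<forall>x<u. \<not> R (ereal r) i x) \<longleftrightarrow>
      (\<forall>e. (\<exists>s. ok s e) \<longrightarrow> (\<exists>s. ok s e \<and> Q s e \<le> i))" for i
  proof (intro iffI allI impI)
    fix e assume a: "\<forall>x<u. \<not> R (ereal r) i x" "\<exists>s. ok s e"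
    then obtain s0 where s0: "ok s0 e" by blast
    then have "\<not> R (ereal r) i (u - e)" using a(1) by (auto simp: ok_def)
    then obtain s where s: "0 < s" "u - e + c < r - s" "Q s e \<le> i"
      unfolding R_def Q_def by (auto simp: not_less)
    have "Q (min s s0) e \<le> Q s e"
      using s s0 unfolding Q_def ok_def by (intro row_diff_mono) auto
    moreover have "ok (min s s0) e" using s s0 by (auto simp: ok_def)
    ultimately show "\<exists>s. ok s e \<and> Q s e \<le> i" using s(3) by (meson le_trans)
  next
    fix x assume a: "\<forall>e. (\<exists>s. ok s e) \<longrightarrow> (\<exists>s. ok s e \<and> Q s e \<le> i)" "x < u"
    define e where "e = min (u - x) ((r - u - c) / 3)"
    have e_le: "e \<le> u - x" by (simp add: e_def)
    have "ok ((r - u - c) / 3) e" using a(2) assms unfolding e_def by (intro down[OF ok_ex] min.cobounded2) auto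
    then obtain s where s: "ok s e" "Q s e \<le> i" using a(1) by blast
    have "\<rho> x (r - s) - \<rho> x (r + s) \<le> Q s e"
      using s(1) e_le unfolding ok_def Q_def by (intro row_diff) auto
    then have "\<not> i < \<rho> x (r - s) - \<rho> x (r + s)" using s(2) by simp
    then show "\<not> R (ereal r) i x" using s(1) a(2) unfolding R_def ok_def by force
  qed
  have **: "{i. idxR u (ereal r) i} = I"
    unfolding I_def idxR_def P_iff Q_iff using assms by simp
  have "int (P e e) - int (Q e e) = int (\<rho> (u + e) (r - e)) - int (\<rho> (u - e) (r - e))
     - int (\<rho> (u + e) (r + e)) + int (\<rho> (u - e) (r + e))" if "ok e e" for e
    using that anti[of "u - e" "r - e" "r + e"] anti[of "u + e" "r - e" "r + e"]
    unfolding P_def Q_def ok_def by (simp add: of_nat_diff)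
  then have "{int (P e e) - int (Q e e) | e. ok e e} = {int (\<rho> (u + e) (r - e)) - int (\<rho> (u - e) (r - e))
     - int (\<rho> (u + e) (r + e)) + int (\<rho> (u - e) (r + e)) | e. ok e e}"
    by (intro Collect_cong) metis
  then show "finite {i. idxR u (ereal r) i}" "int (card {i. idxR u (ereal r) i}) = box_infimum u r"
    using * unfolding ** box_infimum_def by (simp_all add: ok_def)
qed

text \<open>Levels tending to infinity are written 1/s, matching the 1/e of \<open>mult_inf\<close>.
  No real level lies beyond an infinite death, so \<open>Q\<close> is zero.\<close>

lemma idxL_infinite_index:
  shows "finite {i. idxL u \<infinity> i}" "int (card {i. idxL u \<infinity> i}) = strip_infimum u"
proof -
  define ok where "ok e s \<longleftrightarrow> 0 < e \<and> 0 < s \<and> u + e + c < 1 / s" for e s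
  define P where "P e s = \<rho> (u + e) (1 / s) - \<rho> (u - e) (1 / s)" for e s
  define Q where "Q e s = (0::nat)" for e s :: real
  have ok_ex: "ok 1 (1 / (\<bar>u + 1 + c\<bar> + 1))" by (auto simp: ok_def)
  have pos: "0 < e \<and> 0 < s" if "ok e s" for e s using that by (simp add: ok_def)
  have down: "ok e' s'" if a: "ok e s" "0 < e'" "e' \<le> e" "0 < s'" "s' \<le> s" for e s e' s'
  proof -
    have "1 / s \<le> 1 / s'" using a by (simp add: frac_le)
    then show ?thesis using a by (simp add: ok_def)
  qed
  have P_mono: "P e' s' \<le> P e s"
    if a: "ok e s" "0 < e'" "e' \<le> e" "0 < s'" "s' \<le> s" for e s e' s'
  proof -
    have s: "1 / s \<le> 1 / s'" using a by (simp add: frac_le)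
    have "P e' s' \<le> P e s'" using a s unfolding P_def ok_def by (intro col_diff_mono) auto
    also have "\<dots> \<le> P e s" using a s unfolding P_def ok_def by (intro col_diff) auto
    finally show ?thesis .
  qed
  have rect: "P e' s' - Q e' s' \<le> P e s - Q e s"
    if "ok e s" "0 < e'" "e' \<le> e" "0 < s'" "s' \<le> s" for e s e' s'
    using P_mono[OF that] by (simp add: Q_def)
  have Q_mono: "Q e' s \<le> Q e s" if "ok e s" "0 < e'" "e' \<le> e" for e s e' by (simp add: Q_def)
  have Q_anti: "Q e s \<le> Q e s'" if "ok e s" "0 < s'" "s' \<le> s" for e s s' by (simp add: Q_def)
  have QP: "Q e s \<le> P e s" if "ok e s" for e s by (simp add: Q_def)
  define I where "I = {i. (\<forall>e s. ok e s \<longrightarrow> i < P e s) \<and>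
    (\<forall>s. (\<exists>e. ok e s) \<longrightarrow> (\<exists>e. ok e s \<and> Q e s \<le> i))}"
  have *: "finite I" "int (card I) = Inf {int (P e e) - int (Q e e) | e. ok e e}"
    unfolding I_def
    by (rule limit_index_set[where ok = ok and P = P and Q = Q], rule ok_ex, fact pos, fact down,
        fact P_mono, fact Q_mono, fact Q_anti, fact QP, fact rect)+
  have P_iff: "(\<forall>x. u + c < x \<longrightarrow> ereal x < \<infinity> \<longrightarrow> L u i x) \<longleftrightarrow> (\<forall>e s. ok e s \<longrightarrow> i < P e s)" for i
  proof (intro iffI allI impI)
    fix e s assume "\<forall>x. u + c < x \<longrightarrow> ereal x < \<infinity> \<longrightarrow> L u i x" "ok e s"
    then have "L u i (1 / s)" "0 < e" "u + e + c < 1 / s" by (auto simp: ok_def)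
    then show "i < P e s" unfolding P_def L_def by blast
  next
    fix x assume a: "\<forall>e s. ok e s \<longrightarrow> i < P e s" "u + c < x"
    show "L u i x" unfolding L_def
    proof (intro allI impI)
      fix e :: real assume e: "0 < e" "u + e + c < x"
      \<comment> \<open>The level must be positive to have the form 1/s; raising it only lowers the
        column difference.\<close>
      let ?y = "max x 1"
      have "ok e (1 / ?y)" using e by (auto simp: ok_def)
      then have "i < \<rho> (u + e) ?y - \<rho> (u - e) ?y" using a(1) by (force simp: P_def)
      also have "\<dots> \<le> \<rho> (u + e) x - \<rho> (u - e) x" using e by (intro col_diff) auto
      finally show "i < \<rho> (u + e) x - \<rho> (u - e) x" .
    qed
  qed
  have "I = {i. \<forall>e s. ok e s \<longrightarrow> i < P e s}" unfolding I_def Q_def by auto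
  then have **: "{i. idxL u \<infinity> i} = I"
    unfolding idxL_def P_iff by auto
  have "int (P e e) - int (Q e e) = int (\<rho> (u + e) (1 / e)) - int (\<rho> (u - e) (1 / e))"
    if "ok e e" for e
    using that mono[of "u - e" "u + e" "1 / e"]
    unfolding P_def Q_def ok_def by (simp add: of_nat_diff)
  then have "{int (P e e) - int (Q e e) | e. ok e e} =
      {int (\<rho> (u + e) (1 / e)) - int (\<rho> (u - e) (1 / e)) | e. ok e e}"
    by (intro Collect_cong) metis
  then show "finite {i. idxL u \<infinity> i}" "int (card {i. idxL u \<infinity> i}) = strip_infimum u"
    using * unfolding ** strip_infimum_def by (simp_all add: ok_def)
qed

text \<open>Among bars that never die, those born by u - e have smaller numbers than those born near
  u; hence \<open>Q\<close> is a rank here and not zero.\<close>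

lemma idxR_infinite_index:
  shows "finite {i. idxR u \<infinity> i}" "int (card {i. idxR u \<infinity> i}) = strip_infimum u"
proof -
  define ok where "ok s e \<longleftrightarrow> 0 < s \<and> 0 < e \<and> u + e + c < 1 / s" for e s
  define P where "P s e = \<rho> (u + e) (1 / s)" for e s
  define Q where "Q s e = \<rho> (u - e) (1 / s)" for e s
  \<comment> \<open>Every positive e admits some s, and 1/s can be made at least any prescribed
    v.\<close>
  have ok_all: "ok (1 / max v (\<bar>u + e + c\<bar> + 1)) e" if "0 < e" for e v
  proof -
    have "0 < max v (\<bar>u + e + c\<bar> + 1)" "u + e + c < max v (\<bar>u + e + c\<bar> + 1)" by linarith+
    then show ?thesis using that by (simp add: ok_def)
  qed
  have ok_ex: "ok (1 / max 1 (\<bar>u + 1 + c\<bar> + 1)) 1" by (rule ok_all) simp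
  have pos: "0 < s \<and> 0 < e" if "ok s e" for e s using that by (simp add: ok_def)
  have down: "ok s' e'" if a: "ok s e" "0 < s'" "s' \<le> s" "0 < e'" "e' \<le> e" for e s e' s'
  proof -
    have "1 / s \<le> 1 / s'" using a by (simp add: frac_le)
    then show ?thesis using a by (simp add: ok_def)
  qed
  have P_mono: "P s' e' \<le> P s e"
    if a: "ok s e" "0 < s'" "s' \<le> s" "0 < e'" "e' \<le> e" for e s e' s'
  proof -
    have s: "1 / s \<le> 1 / s'" using a by (simp add: frac_le)
    have "P s' e' \<le> P s' e" using a s unfolding P_def ok_def by (intro mono) auto
    also have "\<dots> \<le> P s e" using a s unfolding P_def ok_def by (intro anti) auto
    finally show ?thesis .
  qed
  have Q_mono: "Q s' e \<le> Q s e" if "ok s e" "0 < s'" "s' \<le> s" for e s s'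
    using that frac_le[of 1 1 s' s] unfolding ok_def Q_def by (intro anti) auto
  have Q_anti: "Q s e \<le> Q s e'" if "ok s e" "0 < e'" "e' \<le> e" for e s e'
    using that unfolding ok_def Q_def by (intro mono) auto
  have QP: "Q s e \<le> P s e" if "ok s e" for e s
    using that unfolding P_def Q_def ok_def by (intro mono) auto
  have rect: "P s' e' - Q s' e' \<le> P s e - Q s e"
    if a: "ok s e" "0 < s'" "s' \<le> s" "0 < e'" "e' \<le> e" for e s e' s'
  proof -
    have s: "1 / s \<le> 1 / s'" using a by (simp add: frac_le)
    have "P s' e' - Q s' e' \<le> P s' e - Q s' e"
      using a s unfolding P_def Q_def ok_def by (intro col_diff_mono) auto
    also have "\<dots> \<le> P s e - Q s e" using a s unfolding P_def Q_def ok_def by (intro col_diff) auto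
    finally show ?thesis .
  qed
  define I where "I = {i. (\<forall>s e. ok s e \<longrightarrow> i < P s e) \<and>
    (\<forall>e. (\<exists>s. ok s e) \<longrightarrow> (\<exists>s. ok s e \<and> Q s e \<le> i))}"
  have *: "finite I" "int (card I) = Inf {int (P e e) - int (Q e e) | e. ok e e}"
    unfolding I_def
    by (rule limit_index_set[where ok = ok and P = P and Q = Q], rule ok_ex, fact pos, fact down,
        fact P_mono, fact Q_mono, fact Q_anti, fact QP, fact rect)+
  have P_iff: "(\<forall>x>u. ereal (x + c) < \<infinity> \<longrightarrow> R \<infinity> i x) \<longleftrightarrow> (\<forall>s e. ok s e \<longrightarrow> i < P s e)" for i
  proof (intro iffI allI impI)
    fix e s assume "\<forall>x>u. ereal (x + c) < \<infinity> \<longrightarrow> R \<infinity> i x" "ok s e"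
    then have "R \<infinity> i (u + e)" "0 < s" "u + e + c < 1 / s" by (auto simp: ok_def)
    then show "i < P s e" unfolding P_def R_def by auto
  next
    fix x assume a: "\<forall>s e. ok s e \<longrightarrow> i < P s e" "u < x"
    have "i < \<rho> x v" if v: "x + c < v" for v
    proof -
      let ?y = "max v 1"
      have "ok (1 / ?y) (x - u)" using v a(2) by (auto simp: ok_def)
      then have "i < \<rho> x ?y" using a(1) by (force simp: P_def)
      also have "\<dots> \<le> \<rho> x v" using v by (intro anti) auto
      finally show ?thesis .
    qed
    then show "R \<infinity> i x" by (simp add: R_def)
  qed
  have Q_iff: "(\<forall>x<u. \<not> R \<infinity> i x) \<longleftrightarrow>
      (\<forall>e. (\<exists>s. ok s e) \<longrightarrow> (\<exists>s. ok s e \<and> Q s e \<le> i))" for i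
  proof (intro iffI allI impI)
    fix e assume a: "\<forall>x<u. \<not> R \<infinity> i x" "\<exists>s. ok s e"
    then have e: "0 < e" by (auto simp: ok_def)
    then have "\<not> R \<infinity> i (u - e)" using a(1) by auto
    then obtain v where v: "u - e + c < v" "\<rho> (u - e) v \<le> i" unfolding R_def by (auto simp: not_less)
    let ?y = "max v (\<bar>u + e + c\<bar> + 1)"
    have "\<rho> (u - e) ?y \<le> \<rho> (u - e) v" using v by (intro anti) auto
    then have "Q (1 / ?y) e \<le> i" using v(2) by (simp add: Q_def)
    then show "\<exists>s. ok s e \<and> Q s e \<le> i" using ok_all[OF e] by blast
  next
    fix x assume a: "\<forall>e. (\<exists>s. ok s e) \<longrightarrow> (\<exists>s. ok s e \<and> Q s e \<le> i)" "x < u"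
    then have "\<exists>s. ok s (u - x)" using ok_all[of "u - x"] by auto
    then obtain s where "ok s (u - x)" "Q s (u - x) \<le> i" using a(1) by blast
    then show "\<not> R \<infinity> i x" by (auto simp: R_def ok_def Q_def not_less intro!: exI[of _ "1 / s"])
  qed
  have **: "{i. idxR u \<infinity> i} = I"
    unfolding I_def idxR_def P_iff Q_iff by simp
  have "{int (P e e) - int (Q e e) | e. ok e e} =
      {int (\<rho> (u + e) (1 / e)) - int (\<rho> (u - e) (1 / e)) | e. ok e e}"
    by (simp add: P_def Q_def)
  then show "finite {i. idxR u \<infinity> i}" "int (card {i. idxR u \<infinity> i}) = strip_infimum u"
    using * unfolding ** strip_infimum_def by (simp_all add: ok_def)
qed

text \<open>This is what allows the mixed bars at one cornerpoint to be renumbered from the birth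
  side to the death side.\<close>

lemma idx_card:
  shows "finite {i. idxL u w i}" "finite {i. idxR u w i}"
    and "card {i. idxL u w i} = card {i. idxR u w i}"
proof -
  have "finite {i. idxL u w i} \<and> finite {i. idxR u w i} \<and> card {i. idxL u w i} = card {i. idxR u w i}"
  proof (cases "ereal (u + c) < w")
    case False
    then show ?thesis by (simp add: idxL_def idxR_def)
  next
    case True
    then show ?thesis
    proof (cases w)
      case (real r)
      then show ?thesis using True idxL_finite_index[of u r] idxR_finite_index[of u r] by simp
    next
      case PInf
      then show ?thesis using idxL_infinite_index[of u] idxR_infinite_index[of u] by simp
    qed simp
  qed
  then show "finite {i. idxL u w i}" "finite {i. idxR u w i}"
    "card {i. idxL u w i} = card {i. idxR u w i}" by auto
qed

lemma pdiag_eq_card: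
  assumes "c = 0"
  shows "pdiag \<rho> (u, w) = card {i. idxL u w i}" "pdiag \<rho> (u, w) = card {i. idxR u w i}"
proof -
  show "pdiag \<rho> (u, w) = card {i. idxL u w i}"
  proof (cases "w = \<infinity>")
    case True
    then show ?thesis using idxL_infinite_index(2)[of u]
      unfolding strip_infimum_def pdiag_def mult_inf_def by (simp add: assms)
  next
    case False
    show ?thesis
    proof (cases "ereal u < w")
      case True
      then obtain r where r: "w = ereal r" "u < r" using False by (cases w) auto
      then show ?thesis using idxL_finite_index(2)[of u r]
        unfolding box_infimum_def pdiag_def mult_proper_def by (simp add: assms)
    next
      case False
      then show ?thesis using \<open>w \<noteq> \<infinity>\<close> unfolding idxL_def by (simp add: pdiag_def assms)
    qed
  qed
  then show "pdiag \<rho> (u, w) = card {i. idxR u w i}" by (simp add: idx_card(3))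
qed

end

section \<open>The matching induced by an intermediate rank function\<close>

text \<open>The \<open>col\<close> conditions compare \<kappa> with \<open>\<rho>\<^sub>1\<close> at
  fixed births, the \<open>row\<close> conditions compare it with \<open>\<rho>\<^sub>2\<close> at
  fixed deaths. The last two serve infinite deaths, where \<open>R\<close> is a rank and not a
  difference. The bound 2 \<epsilon> is the shift \<epsilon> plus the slack \<epsilon> of
  \<kappa>.\<close>

locale interleaved_ranks =
  A: rank_region \<rho>\<^sub>1 0 + K: rank_region \<kappa> \<epsilon> + B: rank_region \<rho>\<^sub>2 0
  for \<rho>\<^sub>1 \<kappa> \<rho>\<^sub>2 :: "real \<Rightarrow> real \<Rightarrow> nat" and \<epsilon> :: real +
  assumes nonneg: "0 \<le> \<epsilon>"
    and col_mid: "\<And>a b w. a \<le> b \<Longrightarrow> b < w \<Longrightarrow>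
      \<kappa> b (w + \<epsilon>) - \<kappa> a (w + \<epsilon>) \<le> \<rho>\<^sub>1 b w - \<rho>\<^sub>1 a w"
    and mid_col: "\<And>a b w. a \<le> b \<Longrightarrow> b + \<epsilon> < w \<Longrightarrow>
      \<rho>\<^sub>1 b (w + \<epsilon>) - \<rho>\<^sub>1 a (w + \<epsilon>) \<le> \<kappa> b w - \<kappa> a w"
    and row_mid: "\<And>u v w. u + \<epsilon> < v \<Longrightarrow> v \<le> w \<Longrightarrow>
      \<kappa> u v - \<kappa> u w \<le> \<rho>\<^sub>2 (u + \<epsilon>) v - \<rho>\<^sub>2 (u + \<epsilon>) w"
    and mid_row: "\<And>u v w. u + 2 * \<epsilon> < v \<Longrightarrow> v \<le> w \<Longrightarrow>
      \<rho>\<^sub>2 u v - \<rho>\<^sub>2 u w \<le> \<kappa> (u + \<epsilon>) v - \<kappa> (u + \<epsilon>) w"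
    and mid_le: "\<And>u v. u + \<epsilon> < v \<Longrightarrow> \<kappa> u v \<le> \<rho>\<^sub>2 (u + \<epsilon>) v"
    and le_mid: "\<And>u v. u + 2 * \<epsilon> < v \<Longrightarrow> \<rho>\<^sub>2 u v \<le> \<kappa> (u + \<epsilon>) v"
begin

section \<open>Transfer of bars between the mixed barcode and the two given ones\<close>

lemma L_from_mid:
  assumes "K.L u i x" "u + \<epsilon> < x"
  shows "A.L u i (x - \<epsilon>)"
  unfolding A.L_def
proof (intro allI impI)
  fix e :: real assume e: "0 < e" "u + e + 0 < x - \<epsilon>"
  then have "i < \<kappa> (u + e) x - \<kappa> (u - e) x" using assms by (auto simp: K.L_def)
  also have "\<dots> \<le> \<rho>\<^sub>1 (u + e) (x - \<epsilon>) - \<rho>\<^sub>1 (u - e) (x - \<epsilon>)"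
    using col_mid[of "u - e" "u + e" "x - \<epsilon>"] e by auto
  finally show "i < \<rho>\<^sub>1 (u + e) (x - \<epsilon>) - \<rho>\<^sub>1 (u - e) (x - \<epsilon>)" .
qed

lemma L_to_mid:
  assumes "A.L u i x" "u + 2 * \<epsilon> < x"
  shows "K.L u i (x - \<epsilon>)"
  unfolding K.L_def
proof (intro allI impI)
  fix e :: real assume e: "0 < e" "u + e + \<epsilon> < x - \<epsilon>"
  then have "i < \<rho>\<^sub>1 (u + e) x - \<rho>\<^sub>1 (u - e) x" using assms nonneg by (auto simp: A.L_def)
  also have "\<dots> \<le> \<kappa> (u + e) (x - \<epsilon>) - \<kappa> (u - e) (x - \<epsilon>)"
    using mid_col[of "u - e" "u + e" "x - \<epsilon>"] e by auto
  finally show "i < \<kappa> (u + e) (x - \<epsilon>) - \<kappa> (u - e) (x - \<epsilon>)" .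
qed

lemma R_from_mid:
  assumes "K.R w i x" "ereal (x + \<epsilon>) < w"
  shows "B.R w i (x + \<epsilon>)"
proof (cases w)
  case (real r)
  have "i < \<rho>\<^sub>2 (x + \<epsilon>) (r - s) - \<rho>\<^sub>2 (x + \<epsilon>) (r + s)" if s: "0 < s" "x + \<epsilon> < r - s" for s
  proof -
    have "i < \<kappa> x (r - s) - \<kappa> x (r + s)" using assms s real by (auto simp: K.R_def)
    then show ?thesis using row_mid[of x "r - s" "r + s"] s by linarith
  qed
  then show ?thesis using real by (simp add: B.R_def)
next
  case PInf
  have "i < \<rho>\<^sub>2 (x + \<epsilon>) v" if "x + \<epsilon> < v" for v
  proof -
    have "i < \<kappa> x v" using assms that PInf by (auto simp: K.R_def)
    then show ?thesis using mid_le[OF that] by linarith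
  qed
  then show ?thesis using PInf by (simp add: B.R_def)
qed (use assms in auto)

lemma R_to_mid:
  assumes "B.R w i x" "ereal (x + 2 * \<epsilon>) < w"
  shows "K.R w i (x + \<epsilon>)"
proof (cases w)
  case (real r)
  have "i < \<kappa> (x + \<epsilon>) (r - s) - \<kappa> (x + \<epsilon>) (r + s)" if s: "0 < s" "x + \<epsilon> + \<epsilon> < r - s" for s
  proof -
    have "i < \<rho>\<^sub>2 x (r - s) - \<rho>\<^sub>2 x (r + s)" using assms s real nonneg by (auto simp: B.R_def)
    then show ?thesis using mid_row[of x "r - s" "r + s"] s by linarith
  qed
  then show ?thesis using real by (simp add: K.R_def)
next
  case PInf
  have "i < \<kappa> (x + \<epsilon>) v" if v: "x + \<epsilon> + \<epsilon> < v" for v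
  proof -
    have "i < \<rho>\<^sub>2 x v" using assms v PInf nonneg by (auto simp: B.R_def)
    then show ?thesis using le_mid[of x v] v by linarith
  qed
  then show ?thesis using PInf by (simp add: K.R_def)
qed (use assms in auto)

lemma ereal_less_shift: "ereal a < ereal b + w \<longleftrightarrow> ereal (a - b) < w" "w + ereal b < ereal a \<longleftrightarrow> w < ereal (a - b)"
  by (cases w; auto)+

text \<open>The death is where \<open>L u i\<close> stops holding, and \<open>L_from_mid\<close> and
  \<open>L_to_mid\<close> move this level by at most \<epsilon>. Every mixed bar has a partner: its
  length exceeds \<epsilon>, so a level x - \<epsilon> above u remains.\<close>

lemma birth_match:
  assumes K: "K.idxL u w' i"
  obtains w where "A.idxL u w i" "w \<le> w' + ereal \<epsilon>" "w' \<le> w + ereal \<epsilon>"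
proof -
  have w': "ereal (u + \<epsilon>) < w'" using K by (simp add: K.idxL_def)
  have low: "A.L u i (y - \<epsilon>)" if "u + \<epsilon> < y" "ereal y < w'" for y
    using L_from_mid K that by (auto simp: K.idxL_def)
  obtain x where x: "u + \<epsilon> < x" "ereal x < w'" using ereal_dense2[OF w'] by auto
  then obtain w where w: "A.idxL u w i" using A.idxL_ex[of u "x - \<epsilon>" i] low by auto
  have uw: "ereal u < w" using w by (simp add: A.idxL_def)
  have "w' \<le> w + ereal \<epsilon>"
  proof (rule ccontr)
    assume "\<not> ?thesis"
    then obtain y where y: "w + ereal \<epsilon> < ereal y" "ereal y < w'" using ereal_dense2 by (metis not_le)
    then have "w < ereal (y - \<epsilon>)" by (simp add: ereal_less_shift)
    moreover from uw this have "ereal u < ereal (y - \<epsilon>)" by (rule less_trans)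
    ultimately show False using low[of y] y w by (simp add: A.idxL_def)
  qed
  moreover have "w \<le> w' + ereal \<epsilon>"
  proof (rule ccontr)
    assume "\<not> ?thesis"
    then obtain y where y: "w' + ereal \<epsilon> < ereal y" "ereal y < w" using ereal_dense2 by (metis not_le)
    then have y': "w' < ereal (y - \<epsilon>)" by (simp add: ereal_less_shift)
    then have "ereal (u + \<epsilon>) < ereal (y - \<epsilon>)" using w' by (rule less_trans[rotated])
    then have "u + 2 * \<epsilon> < y" "u < y" using nonneg by auto
    then have "K.L u i (y - \<epsilon>)" using w y(2) by (intro L_to_mid) (auto simp: A.idxL_def)
    then show False using K y' by (simp add: K.idxL_def)
  qed
  ultimately show thesis using that w by blast
qed

text \<open>The converse transfer loses \<epsilon> in the level and \<epsilon> in the slack, hence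
  the length bound. Shorter bars may go to the diagonal at cost at most \<epsilon>.\<close>

lemma birth_match_long:
  assumes "A.idxL u w i" "ereal (u + 2 * \<epsilon>) < w"
  obtains w' where "K.idxL u w' i"
proof -
  obtain x where x: "u + 2 * \<epsilon> < x" "ereal x < w" using ereal_dense2[OF assms(2)] by auto
  then have "K.L u i (x - \<epsilon>)" using assms(1) nonneg by (intro L_to_mid) (auto simp: A.idxL_def)
  then show thesis using K.idxL_ex[of u "x - \<epsilon>" i] x that by auto
qed

text \<open>Here the death is kept and the birth, where \<open>R w i\<close> starts to hold, moves
  by at most \<epsilon> through \<open>R_from_mid\<close> and \<open>R_to_mid\<close>.\<close>

lemma death_match:
  assumes K: "K.idxR u w i"
  obtains u' where "B.idxR u' w i" "\<bar>u - u'\<bar> \<le> \<epsilon>"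
proof -
  have w: "ereal (u + \<epsilon>) < w" using K by (simp add: K.idxR_def)
  have low: "B.R w i (y + \<epsilon>)" if "u < y" "ereal (y + \<epsilon>) < w" for y
    using R_from_mid K that by (auto simp: K.idxR_def)
  obtain x where x: "u + \<epsilon> < x" "ereal x < w" using ereal_dense2[OF w] by auto
  then obtain u' where u': "B.idxR u' w i" using B.idxR_ex[of x w i] low[of "x - \<epsilon>"] by auto
  have "u' \<le> u + \<epsilon>"
  proof (rule ccontr)
    assume "\<not> ?thesis"
    then obtain y where y: "u + \<epsilon> < y" "y < u'" using dense by (meson not_le)
    then have "ereal y < ereal u'" by simp
    then have "ereal y < w" using u' unfolding B.idxR_def by (metis add_0_right less_trans)
    then show False using low[of "y - \<epsilon>"] y u' by (auto simp: B.idxR_def)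
  qed
  moreover have "u \<le> u' + \<epsilon>"
  proof (rule ccontr)
    assume "\<not> ?thesis"
    then obtain y where y: "u' + \<epsilon> < y" "y < u" using dense by (meson not_le)
    then have "ereal (y + \<epsilon>) < ereal (u + \<epsilon>)" by simp
    then have yw: "ereal (y + \<epsilon>) < w" using w by (rule less_trans)
    moreover have "ereal (y - \<epsilon>) \<le> ereal (y + \<epsilon>)" using nonneg by simp
    ultimately have "ereal (y - \<epsilon>) < w" by (meson le_less_trans)
    then have "B.R w i (y - \<epsilon>)" using u' y by (auto simp: B.idxR_def)
    then have "K.R w i (y - \<epsilon> + \<epsilon>)" using yw by (intro R_to_mid) (auto simp: add.commute)
    then show False using K y(2) by (auto simp: K.idxR_def)
  qed
  ultimately show thesis using that u' by (auto simp: abs_le_iff)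
qed

lemma death_match_long:
  assumes "B.idxR u' w i" "ereal (u' + 2 * \<epsilon>) < w"
  obtains u where "K.idxR u w i"
proof -
  obtain x where x: "u' + 2 * \<epsilon> < x" "ereal x < w" using ereal_dense2[OF assms(2)] by auto
  have "ereal (x - 2 * \<epsilon>) \<le> ereal x" using nonneg by simp
  then have "ereal (x - 2 * \<epsilon>) < w" using x(2) by (rule le_less_trans)
  then have "B.R w i (x - 2 * \<epsilon>)" using assms(1) x by (auto simp: B.idxR_def)
  then have "K.R w i (x - 2 * \<epsilon> + \<epsilon>)" using x by (intro R_to_mid) auto
  then show thesis using K.idxR_ex[of "x - 2 * \<epsilon> + \<epsilon>" w i] x that by auto
qed

end

text \<open>Copies of a cornerpoint are labelled from 0 by \<open>labelled\<close>, whereas its bar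
  numbers need not start at 0; only the sizes of the two sets agree.\<close>

lemma enumerate_labels:
  assumes "\<And>p. finite {i. I p i}" "\<And>p. D p = card {i. I p i}"
  obtains h where "\<And>p. bij_betw (h p) {..<D p} {i. I p i}"
proof -
  have "\<exists>h. bij_betw h {..<D p} {i. I p i}" for p
    using assms by (intro finite_same_card_bij) auto
  then show thesis using that by metis
qed

context interleaved_ranks
begin

lemma bottleneck_le: "bottleneck (pdiag \<rho>\<^sub>1) (pdiag \<rho>\<^sub>2) \<le> ereal \<epsilon>"
proof -
  have card_A: "pdiag \<rho>\<^sub>1 p = card {i. A.idxL (fst p) (snd p) i}" for p
    using A.pdiag_eq_card(1)[of "fst p" "snd p"] by simp
  obtain hA where hA: "\<And>p. bij_betw (hA p) {..<pdiag \<rho>\<^sub>1 p} {i. A.idxL (fst p) (snd p) i}"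
    using enumerate_labels[of "\<lambda>p. A.idxL (fst p) (snd p)" "pdiag \<rho>\<^sub>1", OF A.idx_card(1) card_A]
    by blast
  have card_B: "pdiag \<rho>\<^sub>2 p = card {i. B.idxR (fst p) (snd p) i}" for p
    using B.pdiag_eq_card(2)[of "fst p" "snd p"] by simp
  obtain hB where hB: "\<And>p. bij_betw (hB p) {..<pdiag \<rho>\<^sub>2 p} {i. B.idxR (fst p) (snd p) i}"
    using enumerate_labels[of "\<lambda>p. B.idxR (fst p) (snd p)" "pdiag \<rho>\<^sub>2", OF B.idx_card(2) card_B]
    by blast
  \<comment> \<open>The joint of the two matchings: \<open>t u w\<close> turns numbers counted at
    the birth u into numbers counted at the death w.\<close>
  have "\<exists>t. bij_betw t {i. K.idxL u w i} {i. K.idxR u w i}" for u w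
    using K.idx_card by (intro finite_same_card_bij) auto
  then obtain t where t: "\<And>u w. bij_betw (t u w) {i. K.idxL u w i} {i. K.idxR u w i}" by metis
  have A_idx: "A.idxL u w (hA (u, w) j)" if "j < pdiag \<rho>\<^sub>1 (u, w)" for u w j
    using bij_betwE[OF hA[of "(u, w)"]] that by auto
  have B_idx: "B.idxR u w (hB (u, w) j)" if "j < pdiag \<rho>\<^sub>2 (u, w)" for u w j
    using bij_betwE[OF hB[of "(u, w)"]] that by auto
  have K_idx: "K.idxR u w (t u w i)" if "K.idxL u w i" for u w i
    using bij_betwE[OF t[of u w]] that by auto
  have A_surj: "\<exists>j<pdiag \<rho>\<^sub>1 (u, w). hA (u, w) j = i" if "A.idxL u w i" for u w i
  proof -
    have "i \<in> hA (u, w) ` {..<pdiag \<rho>\<^sub>1 (u, w)}"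
      using that by (simp add: bij_betw_imp_surj_on[OF hA[of "(u, w)"]])
    then show ?thesis by auto
  qed
  have B_surj: "\<exists>j<pdiag \<rho>\<^sub>2 (u, w). hB (u, w) j = i" if "B.idxR u w i" for u w i
  proof -
    have "i \<in> hB (u, w) ` {..<pdiag \<rho>\<^sub>2 (u, w)}"
      using that by (simp add: bij_betw_imp_surj_on[OF hB[of "(u, w)"]])
    then show ?thesis by auto
  qed
  have K_surj: "\<exists>j. K.idxL u w j \<and> t u w j = i" if "K.idxR u w i" for u w i
  proof -
    have "i \<in> t u w ` {i. K.idxL u w i}" using that by (simp add: bij_betw_imp_surj_on[OF t])
    then show ?thesis by auto
  qed
  have A_inj: "j = j'" if "j < pdiag \<rho>\<^sub>1 p" "j' < pdiag \<rho>\<^sub>1 p" "hA p j = hA p j'" for p j j'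
    using bij_betw_imp_inj_on[OF hA[of p]] that by (auto dest: inj_onD)
  have B_inj: "j = j'" if "j < pdiag \<rho>\<^sub>2 p" "j' < pdiag \<rho>\<^sub>2 p" "hB p j = hB p j'" for p j j'
    using bij_betw_imp_inj_on[OF hB[of p]] that by (auto dest: inj_onD)
  have K_inj: "i = i'" if "K.idxL u w i" "K.idxL u w i'" "t u w i = t u w i'" for u w i i'
    using bij_betw_imp_inj_on[OF t[of u w]] that by (auto dest: inj_onD)
  \<comment> \<open>A pair follows one mixed bar (u, w'): birth and number come from the first
    diagram, death and renumbered index from the second.\<close>
  define M where "M = {(((u, w), j), ((u', w'), j')) | u w j u' w' j'.
    j < pdiag \<rho>\<^sub>1 (u, w) \<and> j' < pdiag \<rho>\<^sub>2 (u', w') \<and> K.idxL u w' (hA (u, w) j) \<and>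
    hB (u', w') j' = t u w' (hA (u, w) j)}"
  have M: "(((u, w), j), ((u', w'), j')) \<in> M \<longleftrightarrow>
    j < pdiag \<rho>\<^sub>1 (u, w) \<and> j' < pdiag \<rho>\<^sub>2 (u', w') \<and> K.idxL u w' (hA (u, w) j) \<and>
    hB (u', w') j' = t u w' (hA (u, w) j)" for u w j u' w' j'
    by (simp add: M_def)
  \<comment> \<open>Birth and number determine the mixed death w'; this death and the transferred
    number then determine u'. Injectivity runs through the same chain backwards.\<close>
  have functional: "u' = u'' \<and> w' = w'' \<and> j' = j''"
    if "(((u, w), j), ((u', w'), j')) \<in> M" "(((u, w), j), ((u'', w''), j'')) \<in> M" for u w j u' w' j' u'' w'' j''
  proof -
    note m = that[unfolded M]
    have w: "w' = w''" using m K.idxL_unique by blast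
    then have "u' = u''" using m B_idx[of j' u' w'] B_idx[of j'' u'' w''] B.idxR_unique by metis
    then show ?thesis using w m B_inj by metis
  qed
  have injective: "u = v \<and> w = x \<and> j = i"
    if "(((u, w), j), ((u', w'), j')) \<in> M" "(((v, x), i), ((u', w'), j')) \<in> M" for u w j v x i u' w' j'
  proof -
    note m = that[unfolded M]
    have u: "u = v" using m K_idx[of u w' "hA (u, w) j"] K_idx[of v w' "hA (v, x) i"] K.idxR_unique by metis
    then have h: "hA (u, w) j = hA (v, x) i" using m K_inj by metis
    have "w = x" using m u h A_idx[of j u w] A_idx[of i v x] A.idxL_unique by metis
    then show ?thesis using u h m A_inj by metis
  qed
  have matching: "is_matching (pdiag \<rho>\<^sub>1) (pdiag \<rho>\<^sub>2) M"
    unfolding is_matching_def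
  proof (intro conjI allI impI)
    show "M \<subseteq> labelled (pdiag \<rho>\<^sub>1) \<times> labelled (pdiag \<rho>\<^sub>2)" by (auto simp: M_def labelled_def)
  next
    fix a b b' :: "(real \<times> ereal) \<times> nat" assume "(a, b) \<in> M \<and> (a, b') \<in> M"
    then show "b = b'" by (cases a; cases b; cases b') (use functional in force)
  next
    fix a a' b :: "(real \<times> ereal) \<times> nat" assume "(a, b) \<in> M \<and> (a', b) \<in> M"
    then show "a = a'" by (cases a; cases a'; cases b) (use injective in force)
  qed
  have matched: "cdist (u, w) (u', w') \<le> ereal \<epsilon>" if "(((u, w), j), ((u', w'), j')) \<in> M" for u w j u' w' j'
  proof -
    note m = that[unfolded M]
    obtain w'' where "A.idxL u w'' (hA (u, w) j)" "w'' \<le> w' + ereal \<epsilon>" "w' \<le> w'' + ereal \<epsilon>"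
      using m birth_match by blast
    then have w: "w \<le> w' + ereal \<epsilon>" "w' \<le> w + ereal \<epsilon>" using A_idx m A.idxL_unique by metis+
    obtain u'' where "B.idxR u'' w' (hB (u', w') j')" "\<bar>u - u''\<bar> \<le> \<epsilon>"
      using death_match K_idx m by metis
    then have u: "\<bar>u - u'\<bar> \<le> \<epsilon>" using B_idx m B.idxR_unique by metis
    have "ereal u < w" using A_idx m by (auto simp: A.idxL_def)
    moreover have "ereal u' < w'" using B_idx m by (auto simp: B.idxR_def)
    ultimately show ?thesis using u w by (cases w; cases w') (auto simp: cdist_def)
  qed
  \<comment> \<open>A bar longer than 2 \<epsilon> has a mixed partner, and every mixed bar
    continues to the second barcode. An unmatched bar thus has half-length at most
    \<epsilon>.\<close>
  have unmatched_A: "ddiag (u, w) \<le> ereal \<epsilon>"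
    if j: "j < pdiag \<rho>\<^sub>1 (u, w)" and un: "((u, w), j) \<notin> fst ` M" for u w j
  proof -
    let ?i = "hA (u, w) j"
    have "\<not> ereal (u + 2 * \<epsilon>) < w"
    proof
      assume "ereal (u + 2 * \<epsilon>) < w"
      then obtain w' where w': "K.idxL u w' ?i" using birth_match_long A_idx[OF j] by blast
      then obtain u' where "B.idxR u' w' (t u w' ?i)" using death_match K_idx by blast
      then obtain j' where "j' < pdiag \<rho>\<^sub>2 (u', w')" "hB (u', w') j' = t u w' ?i" using B_surj by blast
      then have "(((u, w), j), ((u', w'), j')) \<in> M" using M j w' by blast
      then show False using un by force
    qed
    moreover have "ereal u < w" using A_idx[OF j] by (simp add: A.idxL_def)
    ultimately show ?thesis by (cases w) (auto simp: ddiag_def)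
  qed
  have unmatched_B: "ddiag (u', w') \<le> ereal \<epsilon>"
    if j: "j' < pdiag \<rho>\<^sub>2 (u', w')" and un: "((u', w'), j') \<notin> snd ` M" for u' w' j'
  proof -
    let ?k = "hB (u', w') j'"
    have "\<not> ereal (u' + 2 * \<epsilon>) < w'"
    proof
      assume "ereal (u' + 2 * \<epsilon>) < w'"
      then obtain u where u: "K.idxR u w' ?k" using death_match_long B_idx[OF j] by blast
      then obtain i where i: "K.idxL u w' i" "t u w' i = ?k" using K_surj by blast
      then obtain w where "A.idxL u w i" using birth_match by blast
      then obtain j where "j < pdiag \<rho>\<^sub>1 (u, w)" "hA (u, w) j = i" using A_surj by blast
      then have "(((u, w), j), ((u', w'), j')) \<in> M" using M j i by auto
      then show False using un by force
    qed
    moreover have "ereal u' < w'" using B_idx[OF j] by (simp add: B.idxR_def)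
    ultimately show ?thesis by (cases w') (auto simp: ddiag_def)
  qed
  have "matching_cost (pdiag \<rho>\<^sub>1) (pdiag \<rho>\<^sub>2) M \<le> ereal \<epsilon>"
    unfolding matching_cost_def
  proof (rule Sup_least)
    fix x assume "x \<in> {0} \<union> {cdist (fst a) (fst b) | a b. (a, b) \<in> M}
      \<union> {ddiag (fst a) | a. a \<in> labelled (pdiag \<rho>\<^sub>1) \<and> a \<notin> fst ` M}
      \<union> {ddiag (fst b) | b. b \<in> labelled (pdiag \<rho>\<^sub>2) \<and> b \<notin> snd ` M}"
    then consider "x = 0" | a b where "(a, b) \<in> M" "x = cdist (fst a) (fst b)"
      | a where "a \<in> labelled (pdiag \<rho>\<^sub>1)" "a \<notin> fst ` M" "x = ddiag (fst a)"
      | b where "b \<in> labelled (pdiag \<rho>\<^sub>2)" "b \<notin> snd ` M" "x = ddiag (fst b)"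
      by blast
    then show "x \<le> ereal \<epsilon>"
    proof cases
      case 1
      then show ?thesis using nonneg by simp
    next
      case (2 a b)
      obtain u w j u' w' j' where "a = ((u, w), j)" "b = ((u', w'), j')" by (metis prod.collapse)
      then show ?thesis using 2 matched by simp
    next
      case (3 a)
      obtain u w j where "a = ((u, w), j)" by (metis prod.collapse)
      then show ?thesis using 3 unmatched_A[of j u w] by (simp add: labelled_def)
    next
      case (4 b)
      obtain u w j where "b = ((u, w), j)" by (metis prod.collapse)
      then show ?thesis using 4 unmatched_B[of j u w] by (simp add: labelled_def)
    qed
  qed
  moreover have "bottleneck (pdiag \<rho>\<^sub>1) (pdiag \<rho>\<^sub>2) \<le> matching_cost (pdiag \<rho>\<^sub>1) (pdiag \<rho>\<^sub>2) M"
    unfolding bottleneck_def using matching by (intro Inf_lower) blast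
  ultimately show ?thesis by (rule order_trans[rotated])
qed

end

section \<open>Persistent Betti numbers as relative dimensions\<close>

text \<open>The ambient space consists of all coefficient functions with pointwise operations.
  Cycles and boundaries at all levels are subsets of it, so no quotient space has to be
  formed.\<close>

global_interpretation chain_space: relative_dimension "\<lambda>a c \<sigma>. (a::'k::field) * c (\<sigma>::'s)"
  by unfold_locales (auto simp: fun_eq_iff algebra_simps)

lemma sum_fun_apply: "(\<Sum>v\<in>T. f v) \<sigma> = (\<Sum>v\<in>T. f v \<sigma>)"
  for f :: "'b \<Rightarrow> 's \<Rightarrow> 'k::comm_monoid_add"
  by (induction T rule: infinite_finite_induct) auto

lemma lspan_eq_span: "lspan S = chain_space.span S"
  unfolding lspan_def chain_space.span_explicit
  by (auto simp: fun_eq_iff sum_fun_apply intro!: exI)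

lemma lsubspace_iff_subspace: "lsubspace S \<longleftrightarrow> chain_space.subspace S"
  unfolding lsubspace_def chain_space.subspace_def by (simp add: plus_fun_def zero_fun_def)

text \<open>The isomorphism of Z/(Z \<inter> B) with (Z + B)/B: in z = x + y with x spanned by
  vectors of \<open>Z\<close> and y in \<open>B\<close>, the part y = z - x lies in \<open>Z\<close>
  too. It frees the second argument from \<open>Z\<close>, so that cycles and boundaries can vary
  independently.\<close>

lemma qrank_eq_reldim:
  assumes "chain_space.subspace Z" "chain_space.subspace B"
  shows "qrank Z (Z \<inter> B) = chain_space.reldim Z B"
proof -
  have "Z \<subseteq> chain_space.span (S \<union> (Z \<inter> B))" if "S \<subseteq> Z" "Z \<subseteq> chain_space.span (S \<union> B)" for S
  proof
    fix z assume z: "z \<in> Z"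
    then have "z \<in> chain_space.span (S \<union> B)" using that by blast
    then obtain x y where xy: "z = x + y" "x \<in> chain_space.span S" "y \<in> B"
      using assms(2) unfolding chain_space.span_Un by (auto simp: chain_space.span_eq_iff[THEN iffD2])
    then have "x \<in> Z" using that(1) assms(1) chain_space.span_minimal by blast
    then have "z - x \<in> Z" using z assms(1) chain_space.subspace_diff by blast
    then have "y \<in> Z \<inter> B" using xy by simp
    then show "z \<in> chain_space.span (S \<union> (Z \<inter> B))"
      unfolding xy(1) using xy(2)
      by (intro chain_space.span_add) (auto intro: chain_space.span_base chain_space.span_mono[THEN subsetD, of S])
  qed
  moreover have "Z \<subseteq> chain_space.span (S \<union> B)" if "Z \<subseteq> chain_space.span (S \<union> (Z \<inter> B))" for S
    using that chain_space.span_mono[of "S \<union> (Z \<inter> B)" "S \<union> B"] by blast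
  ultimately have "(\<exists>S. finite S \<and> S \<subseteq> Z \<and> card S = m \<and> Z \<subseteq> lspan (S \<union> (Z \<inter> B))) \<longleftrightarrow>
      (\<exists>S. finite S \<and> S \<subseteq> Z \<and> card S = m \<and> Z \<subseteq> chain_space.span (S \<union> B))" for m
    unfolding lspan_eq_span by (intro ex_cong1 conj_cong refl iffI)
  then show ?thesis unfolding qrank_def chain_space.reldim_def by simp
qed

section \<open>Linearity of the boundary and the pointwise form of sublevel conditions\<close>

lemma supp_add: "supp (\<lambda>\<sigma>. c \<sigma> + d \<sigma>) \<subseteq> supp c \<union> supp (d :: ('a, 'k::field) chain)"
  by (auto simp: supp_def)

lemma supp_scale: "supp (\<lambda>\<sigma>. a * c \<sigma>) \<subseteq> supp (c :: ('a, 'k::field) chain)"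
  by (auto simp: supp_def)

text \<open>Allowing a range larger than the support gives several chains a common range, so that
  their boundaries can be compared term by term.\<close>

lemma bd_eq_sum:
  assumes "finite T" "supp c \<subseteq> T" "n \<noteq> 0"
  shows "bd n c \<tau> = (\<Sum>\<sigma>\<in>T. c \<sigma> * (\<Sum>j\<in>{j. j \<le> n \<and> sing_face n j \<sigma> = \<tau>}. (-1) ^ j))"
  using assms unfolding bd_def by (auto simp: supp_def intro!: sum.mono_neutral_left)

lemma bd_add:
  assumes "finite (supp c)" "finite (supp d)"
  shows "bd n (\<lambda>\<sigma>. c \<sigma> + d \<sigma>) = (\<lambda>\<tau>. bd n c \<tau> + bd n d \<tau>)"
proof (cases "n = 0")
  case False
  have T: "finite (supp c \<union> supp d)" using assms by simp
  show ?thesis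
    by (rule ext)
       (simp add: bd_eq_sum[OF T supp_add False] bd_eq_sum[OF T Un_upper1 False]
         bd_eq_sum[OF T Un_upper2 False] distrib_right sum.distrib)
qed (simp add: bd_def)

lemma bd_scale:
  assumes "finite (supp c)"
  shows "bd n (\<lambda>\<sigma>. a * c \<sigma>) = (\<lambda>\<tau>. a * bd n c \<tau>)"
proof (cases "n = 0")
  case False
  show ?thesis
    by (rule ext)
       (simp add: bd_eq_sum[OF assms supp_scale False] bd_eq_sum[OF assms order_refl False]
         sum_distrib_left mult.assoc)
qed (simp add: bd_def)

lemma bd_zero: "bd n (\<lambda>_. 0) = (\<lambda>_. 0)"
  by (auto simp: bd_def supp_def)

text \<open>The convention of value -\<infinity> for the null chain agrees with the vacuous
  condition over its empty support.\<close>

lemma ev_le_induced_filt: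
  "ev_le (induced_filt \<phi> n c) u \<longleftrightarrow>
    (\<forall>\<sigma>\<in>supp c. \<forall>t\<in>std_simplex n. \<forall>i. \<phi> (\<sigma> t) $ i \<le> u $ i)"
proof (cases "c = (\<lambda>_. 0)")
  case True
  then show ?thesis by (simp add: ev_le_def induced_filt_def supp_def)
next
  case False
  then show ?thesis unfolding ev_le_def induced_filt_def by (auto simp: Sup_le_iff)
qed

lemma std_simplex_nonempty: "std_simplex n \<noteq> {}"
proof -
  have "(\<lambda>i. if i = 0 then 1 else 0) \<in> std_simplex n"
    by (auto simp: std_simplex_def)
  then show ?thesis by blast
qed

lemma sing_simplex_image: "sing_simplex n X \<sigma> \<Longrightarrow> \<sigma> ` std_simplex n \<subseteq> topspace X"
  unfolding sing_simplex_def by (auto dest!: continuous_map_image_subset_topspace)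

definition cycles_below ::
    "(nat \<Rightarrow> ('a, 'k::field) chain set) \<Rightarrow> ('a \<Rightarrow> real^'m) \<Rightarrow> nat \<Rightarrow> real^'m \<Rightarrow> ('a, 'k) chain set" where
  "cycles_below Cbar \<phi> n u = {c \<in> sublevel_chains Cbar \<phi> n u. bd n c = (\<lambda>_. 0)}"

definition boundaries_below ::
    "(nat \<Rightarrow> ('a, 'k::field) chain set) \<Rightarrow> ('a \<Rightarrow> real^'m) \<Rightarrow> nat \<Rightarrow> real^'m \<Rightarrow> ('a, 'k) chain set" where
  "boundaries_below Cbar \<phi> n u = bd (Suc n) ` sublevel_chains Cbar \<phi> (Suc n) u"

locale chain_subcomplex =
  fixes X :: "'a topology" and Cbar :: "nat \<Rightarrow> ('a, 'k::field) chain set"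
  assumes chains: "\<And>n. Cbar n \<subseteq> chains n X"
    and lsubspace: "\<And>n. lsubspace (Cbar n)"
begin

section \<open>Flags of sublevel cycles and boundaries\<close>

lemma finite_supp: "c \<in> Cbar n \<Longrightarrow> finite (supp c)"
  using chains[of n] by (auto simp: chains_def)

lemma simplex_in_space: "c \<in> Cbar n \<Longrightarrow> \<sigma> \<in> supp c \<Longrightarrow> t \<in> std_simplex n \<Longrightarrow> \<sigma> t \<in> topspace X"
  using chains[of n] sing_simplex_image by (fastforce simp: chains_def)

lemma subspace_sublevel: "chain_space.subspace (sublevel_chains Cbar \<phi> n u)"
  unfolding lsubspace_iff_subspace[symmetric] lsubspace_def sublevel_chains_def ev_le_induced_filt
  using lsubspace[of n] unfolding lsubspace_def
  by (auto dest!: supp_add[THEN subsetD] supp_scale[THEN subsetD]) (auto simp: supp_def)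

lemma subspace_cycles: "chain_space.subspace (cycles_below Cbar \<phi> n u)"
proof -
  have "chain_space.subspace {c \<in> sublevel_chains Cbar \<phi> n u. bd n c = (\<lambda>_. 0)}"
    using subspace_sublevel[of \<phi> n u]
    unfolding lsubspace_iff_subspace[symmetric] lsubspace_def
    by (auto simp: bd_zero bd_add bd_scale sublevel_chains_def finite_supp)
  then show ?thesis by (simp add: cycles_below_def)
qed

lemma subspace_boundaries: "chain_space.subspace (boundaries_below Cbar \<phi> n u)"
proof -
  let ?C = "sublevel_chains Cbar \<phi> (Suc n) u"
  have C: "(\<lambda>_. 0) \<in> ?C" "\<And>c d. c \<in> ?C \<Longrightarrow> d \<in> ?C \<Longrightarrow> (\<lambda>\<sigma>. c \<sigma> + d \<sigma>) \<in> ?C"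
    "\<And>a c. c \<in> ?C \<Longrightarrow> (\<lambda>\<sigma>. a * c \<sigma>) \<in> ?C"
    using subspace_sublevel[of \<phi> "Suc n" u] unfolding lsubspace_iff_subspace[symmetric] lsubspace_def
    by auto
  have fin: "finite (supp c)" if "c \<in> ?C" for c
    using that by (auto simp: sublevel_chains_def finite_supp)
  show ?thesis
    unfolding lsubspace_iff_subspace[symmetric] lsubspace_def boundaries_below_def
  proof (intro conjI ballI allI)
    show "(\<lambda>_. 0) \<in> bd (Suc n) ` ?C" using C(1) by (intro image_eqI[where x = "\<lambda>_. 0"]) (auto simp: bd_zero)
  next
    fix c d assume "c \<in> bd (Suc n) ` ?C" "d \<in> bd (Suc n) ` ?C"
    then obtain c' d' where "c' \<in> ?C" "c = bd (Suc n) c'" "d' \<in> ?C" "d = bd (Suc n) d'" by blast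
    then show "(\<lambda>\<sigma>. c \<sigma> + d \<sigma>) \<in> bd (Suc n) ` ?C"
      using C(2) fin by (auto simp flip: bd_add)
  next
    fix a c assume "c \<in> bd (Suc n) ` ?C"
    then obtain c' where "c' \<in> ?C" "c = bd (Suc n) c'" by blast
    then show "(\<lambda>\<sigma>. a * c \<sigma>) \<in> bd (Suc n) ` ?C"
      using C(3) fin by (auto simp flip: bd_scale)
  qed
qed

lemma PBNF_eq_reldim:
  assumes "0 \<le> n"
  shows "PBNF Cbar \<phi> n u v =
    chain_space.reldim (cycles_below Cbar \<phi> (nat n) u) (boundaries_below Cbar \<phi> (nat n) v)"
  using assms qrank_eq_reldim[OF subspace_cycles subspace_boundaries]
  unfolding PBNF_def cycles_below_def boundaries_below_def Let_def by simp

text \<open>Two functions and two levels are allowed so that monotonicity in the level and the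
  \<epsilon>-interleaving of two filtrations are instances of the same statement.\<close>

lemma sublevel_mono:
  assumes "\<And>x. x \<in> topspace X \<Longrightarrow> (\<forall>i. \<phi> x $ i \<le> u $ i) \<Longrightarrow> (\<forall>i. \<psi> x $ i \<le> v $ i)"
  shows "sublevel_chains Cbar \<phi> n u \<subseteq> sublevel_chains Cbar \<psi> n v"
  unfolding sublevel_chains_def ev_le_induced_filt using assms simplex_in_space by blast

lemma cycles_mono:
  assumes "\<And>x. x \<in> topspace X \<Longrightarrow> (\<forall>i. \<phi> x $ i \<le> u $ i) \<Longrightarrow> (\<forall>i. \<psi> x $ i \<le> v $ i)"
  shows "cycles_below Cbar \<phi> n u \<subseteq> cycles_below Cbar \<psi> n v"
  unfolding cycles_below_def using sublevel_mono[of \<phi> u \<psi> v n] assms by blast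

lemma boundaries_mono:
  assumes "\<And>x. x \<in> topspace X \<Longrightarrow> (\<forall>i. \<phi> x $ i \<le> u $ i) \<Longrightarrow> (\<forall>i. \<psi> x $ i \<le> v $ i)"
  shows "boundaries_below Cbar \<phi> n u \<subseteq> boundaries_below Cbar \<psi> n v"
  unfolding boundaries_below_def using sublevel_mono[of \<phi> u \<psi> v "Suc n"] assms by blast

text \<open>Standard simplices are nonempty, so a nonzero chain would provide a point in the
  sublevel set; the empty family therefore generates.\<close>

lemma reldim_cycles_eq_0:
  assumes "\<And>x. x \<in> topspace X \<Longrightarrow> \<not> (\<forall>i. \<phi> x $ i \<le> u $ i)"
  shows "chain_space.reldim (cycles_below Cbar \<phi> n u) B = 0"
proof -
  have "c = 0" if "c \<in> cycles_below Cbar \<phi> n u" for c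
  proof -
    have c: "c \<in> Cbar n" "\<forall>\<sigma>\<in>supp c. \<forall>t\<in>std_simplex n. \<forall>i. \<phi> (\<sigma> t) $ i \<le> u $ i"
      using that by (auto simp: cycles_below_def sublevel_chains_def ev_le_induced_filt)
    obtain t where t: "t \<in> std_simplex n" using std_simplex_nonempty by blast
    have "supp c = {}" using c t assms simplex_in_space by blast
    then show ?thesis by (auto simp: supp_def fun_eq_iff)
  qed
  then show ?thesis
    using chain_space.reldim_le[of "{}" "cycles_below Cbar \<phi> n u" B] chain_space.span_zero by auto
qed

lemma relfin_cycles_boundaries:
  fixes \<phi> :: "'a \<Rightarrow> real^'m"
  assumes star: "property_star X Cbar" and cont: "continuous_map X euclidean \<phi>"
    and uv: "\<And>i. u $ i < v $ i"
  shows "chain_space.relfin (cycles_below Cbar \<phi> n u) (boundaries_below Cbar \<phi> n v)"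
proof -
  define S where "S w = {x \<in> topspace X. \<phi> x \<in> {y. \<forall>i. y $ i \<le> w $ i}}" for w
  define U where "U = {x \<in> topspace X. \<phi> x \<in> {y. \<forall>i. y $ i < v $ i}}"
  have "closed {y :: real^'m. \<forall>i. y $ i \<le> w $ i}" for w
    by (intro closed_Collect_all closed_Collect_le continuous_intros)
  then have S: "closedin X (S w)" for w
    unfolding S_def by (intro closedin_continuous_map_preimage[OF cont]) simp
  have "open {y :: real^'m. \<forall>i. y $ i < v $ i}"
    by (simp add: open_Collect_less_Int Collect_all_eq open_INT open_Collect_less continuous_intros)
  then have "openin X U"
    unfolding U_def by (intro openin_continuous_map_preimage[OF cont]) simp
  moreover have "S u \<subseteq> U" using uv by (auto simp: S_def U_def intro: le_less_trans)
  moreover have "U \<subseteq> S v" by (auto simp: S_def U_def intro: less_imp_le)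
  ultimately have "S u \<subseteq> X interior_of (S v)" using interior_of_maximal by blast
  then obtain Y where Y: "S u \<subseteq> Y" "Y \<subseteq> S v" "fg_homology_in X Cbar Y n"
    using star[unfolded property_star_def, rule_format, of "S u" "S v"] S by auto
  define Z where "Z = {c \<in> Cbar n \<inter> chains_in n X Y. bd n c = (\<lambda>_. 0)}"
  define B where "B = bd (Suc n) ` (Cbar (Suc n) \<inter> chains_in (Suc n) X Y)"
  have "chain_space.relfin Z B"
    using Y(3) unfolding fg_homology_in_def Let_def chain_space.relfin_def lspan_eq_span Z_def B_def .
  moreover have "B \<subseteq> boundaries_below Cbar \<phi> n v"
    unfolding B_def boundaries_below_def
  proof (rule image_mono, rule subsetI)
    fix c assume "c \<in> Cbar (Suc n) \<inter> chains_in (Suc n) X Y"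
    then have "c \<in> Cbar (Suc n)" "\<forall>\<sigma>\<in>supp c. \<forall>t\<in>std_simplex (Suc n). \<sigma> t \<in> S v"
      using Y(2) by (auto simp: chains_in_def)
    then show "c \<in> sublevel_chains Cbar \<phi> (Suc n) v"
      by (simp add: sublevel_chains_def ev_le_induced_filt S_def)
  qed
  ultimately have "chain_space.relfin Z (boundaries_below Cbar \<phi> n v)"
    by (rule chain_space.relfin_antimono)
  moreover have "cycles_below Cbar \<phi> n u \<subseteq> Z"
  proof
    fix c assume c: "c \<in> cycles_below Cbar \<phi> n u"
    then have "c \<in> Cbar n" "bd n c = (\<lambda>_. 0)"
      by (auto simp: cycles_below_def sublevel_chains_def)
    moreover have "\<sigma> t \<in> S u" if "\<sigma> \<in> supp c" "t \<in> std_simplex n" for \<sigma> t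
      using c that simplex_in_space[of c n \<sigma> t]
      by (auto simp: cycles_below_def sublevel_chains_def ev_le_induced_filt S_def)
    ultimately show "c \<in> Z" using chains[of n] Y(1) unfolding Z_def chains_in_def by auto
  qed
  ultimately show ?thesis using chain_space.reldim_additive(1) by blast
qed

end

section \<open>Invariance under the group action\<close>

text \<open>The action of \<open>g\<close> on simplices extended to a bijection of all maps, so that the induced
  map on coefficient functions is a linear bijection of the whole function space.\<close>

definition simplex_transport :: "nat \<Rightarrow> ('a \<Rightarrow> 'a) \<Rightarrow> ((nat \<Rightarrow> real) \<Rightarrow> 'a) \<Rightarrow> ((nat \<Rightarrow> real) \<Rightarrow> 'a)" where
  "simplex_transport n g \<sigma> = (\<lambda>t. if t \<in> std_simplex n then g (\<sigma> t) else \<sigma> t)"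

definition chain_transport :: "nat \<Rightarrow> ('a \<Rightarrow> 'a) \<Rightarrow> ('a, 'k::field) chain \<Rightarrow> ('a, 'k) chain" where
  "chain_transport n g c = (\<lambda>\<tau>. c (simplex_transport n (inv g) \<tau>))"

section \<open>Compatibility of the transport with action, boundary and relative dimension\<close>

lemma simplex_transport_inverse:
  assumes "bij g"
  shows "simplex_transport n (inv g) (simplex_transport n g \<sigma>) = \<sigma>"
    and "simplex_transport n g (simplex_transport n (inv g) \<sigma>) = \<sigma>"
  using assms by (auto simp: simplex_transport_def fun_eq_iff bij_is_inj bij_is_surj surj_f_inv_f)

lemma simplex_transport_eq_iff:
  "bij g \<Longrightarrow> simplex_transport n g \<sigma> = \<tau> \<longleftrightarrow> \<sigma> = simplex_transport n (inv g) \<tau>"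
  using simplex_transport_inverse by metis

lemma chain_transport_inverse:
  assumes "bij g"
  shows "chain_transport n (inv g) (chain_transport n g c) = c"
    and "chain_transport n g (chain_transport n (inv g) c) = c"
  using assms by (auto simp: chain_transport_def simplex_transport_inverse inv_inv_eq)

lemma supp_chain_transport:
  assumes "bij g"
  shows "supp (chain_transport n g c) = simplex_transport n g ` supp c"
proof (intro set_eqI iffI)
  fix \<tau> assume "\<tau> \<in> supp (chain_transport n g c)"
  then have "simplex_transport n (inv g) \<tau> \<in> supp c" by (simp add: supp_def chain_transport_def)
  then show "\<tau> \<in> simplex_transport n g ` supp c"
    using simplex_transport_inverse(2)[OF assms] by (metis image_eqI)
next
  fix \<tau> assume "\<tau> \<in> simplex_transport n g ` supp c"
  then show "\<tau> \<in> supp (chain_transport n g c)"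
    by (auto simp: supp_def chain_transport_def simplex_transport_inverse[OF assms])
qed

text \<open>Singular simplices are \<open>undefined\<close> off the standard simplex, exactly where
  the transport leaves them unchanged and \<open>simp_act\<close> restricts. Injectivity of the
  transport reduces the sum in \<open>chain_act\<close> to at most one term.\<close>

lemma chain_act_eq_transport:
  assumes "bij g" "c \<in> chains n X"
  shows "chain_act n g c = chain_transport n g c"
proof
  fix \<tau>
  have fin: "finite (supp c)" and sing: "\<And>\<sigma>. \<sigma> \<in> supp c \<Longrightarrow> \<sigma> \<in> extensional (std_simplex n)"
    using assms(2) by (auto simp: chains_def sing_simplex_def)
  have "simp_act n g \<sigma> = simplex_transport n g \<sigma>" if "\<sigma> \<in> supp c" for \<sigma>
    using sing[OF that] by (auto simp: simp_act_def simplex_transport_def extensional_def fun_eq_iff)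
  then have "{\<sigma> \<in> supp c. simp_act n g \<sigma> = \<tau>} = supp c \<inter> {simplex_transport n (inv g) \<tau>}"
    by (auto simp: simplex_transport_inverse[OF assms(1)])
  then show "chain_act n g c \<tau> = chain_transport n g c \<tau>"
    unfolding chain_act_def chain_transport_def by (auto simp: supp_def Int_insert_right)
qed

lemma sum_face: "(\<Sum>i\<le>Suc n. simp_face j x i) = (\<Sum>i\<le>n. x i)" if "j \<le> Suc n"
proof -
  have "(\<Sum>i\<le>Suc n. simp_face j x i) = (\<Sum>i\<in>{..Suc n} - {j}. simp_face j x i)"
    using that by (intro sum.mono_neutral_right) (auto simp: simp_face_def)
  also have "\<dots> = (\<Sum>i\<le>n. x i)"
    by (rule sum.reindex_bij_witness[of _ "\<lambda>i. if i < j then i else Suc i" "\<lambda>i. if i < j then i else i - 1"])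
       (use that in \<open>auto simp: simp_face_def\<close>)
  finally show ?thesis .
qed

lemma simp_face_std_simplex:
  assumes "j \<le> Suc n" "x \<in> std_simplex n"
  shows "simp_face j x \<in> std_simplex (Suc n)"
  using assms sum_face[OF assms(1), of x] by (auto simp: std_simplex_def simp_face_def)

lemma sing_face_transport:
  assumes "j \<le> Suc n"
  shows "sing_face (Suc n) j (simplex_transport (Suc n) g \<sigma>) = simplex_transport n g (sing_face (Suc n) j \<sigma>)"
  using simp_face_std_simplex[OF assms]
  by (auto simp: sing_face_def simplex_transport_def fun_eq_iff)

text \<open>Faces commute with postcomposition by g. For each simplex the faces equal to \<tau>
  after transport are those equal to the inverse transport of \<tau> before it, so the sums agree
  after reindexing.\<close>

lemma bd_chain_transport:
  assumes "bij g" "finite (supp c)"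
  shows "bd (Suc n) (chain_transport (Suc n) g c) = chain_transport n g (bd (Suc n) c)"
proof
  fix \<tau>
  let ?S = "simplex_transport (Suc n) g"
  have inj: "inj_on ?S (supp c)"
    using simplex_transport_inverse(1)[OF assms(1)] by (metis inj_onI)
  have face: "{j. j \<le> Suc n \<and> sing_face (Suc n) j (?S \<sigma>) = \<tau>} =
      {j. j \<le> Suc n \<and> sing_face (Suc n) j \<sigma> = simplex_transport n (inv g) \<tau>}" for \<sigma>
    using sing_face_transport simplex_transport_eq_iff[OF assms(1)] by (metis (no_types, lifting))
  have "bd (Suc n) (chain_transport (Suc n) g c) \<tau> =
      (\<Sum>\<sigma>\<in>?S ` supp c. chain_transport (Suc n) g c \<sigma> *
        (\<Sum>j\<in>{j. j \<le> Suc n \<and> sing_face (Suc n) j \<sigma> = \<tau>}. (-1) ^ j))"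
    by (simp add: bd_def supp_chain_transport[OF assms(1)])
  also have "\<dots> = (\<Sum>\<sigma>\<in>supp c. c \<sigma> *
        (\<Sum>j\<in>{j. j \<le> Suc n \<and> sing_face (Suc n) j \<sigma> = simplex_transport n (inv g) \<tau>}. (-1) ^ j))"
    by (simp add: sum.reindex[OF inj] face chain_transport_def simplex_transport_inverse[OF assms(1)])
  also have "\<dots> = chain_transport n g (bd (Suc n) c) \<tau>"
    by (simp add: bd_def chain_transport_def)
  finally show "bd (Suc n) (chain_transport (Suc n) g c) \<tau> = chain_transport n g (bd (Suc n) c) \<tau>" .
qed

lemma chain_transport_span:
  "chain_transport n g ` chain_space.span S = chain_space.span (chain_transport n g ` S)"
proof -
  have "module_hom (\<lambda>a c \<sigma>. (a::'k) * c \<sigma>) (\<lambda>a c \<sigma>. a * c \<sigma>) (chain_transport n g :: ('a, 'k::field) chain \<Rightarrow> _)"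
    by unfold_locales (auto simp: chain_transport_def fun_eq_iff algebra_simps)
  then show ?thesis by (rule module_hom.span_image[symmetric])
qed

text \<open>Generating families are pushed forward along g, and back along its inverse, without
  changing their size.\<close>

lemma reldim_chain_transport:
  fixes Z B :: "('a, 'k::field) chain set"
  assumes "bij g"
  shows "chain_space.reldim (chain_transport n g ` Z) (chain_transport n g ` B) = chain_space.reldim Z B"
proof -
  have push: "\<exists>S'. finite S' \<and> S' \<subseteq> chain_transport n h ` Z \<and> card S' = card S \<and>
      chain_transport n h ` Z \<subseteq> chain_space.span (S' \<union> chain_transport n h ` B)"
    if "finite S" "S \<subseteq> Z" "Z \<subseteq> chain_space.span (S \<union> B)" "bij h" for S Z B :: "('a, 'k) chain set" and h
  proof (intro exI conjI)
    show "card (chain_transport n h ` S) = card S"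
      by (intro card_image inj_on_inverseI[of _ "chain_transport n (inv h)"])
         (simp add: chain_transport_inverse[OF that(4)])
    show "chain_transport n h ` Z \<subseteq> chain_space.span (chain_transport n h ` S \<union> chain_transport n h ` B)"
      using that(3) by (simp flip: image_Un chain_transport_span add: image_mono)
  qed (use that in auto)
  have undo: "chain_transport n (inv g) ` chain_transport n g ` Z = Z" for Z :: "('a, 'k) chain set"
    by (simp add: image_image chain_transport_inverse[OF assms])
  have "(\<exists>S. finite S \<and> S \<subseteq> chain_transport n g ` Z \<and> card S = m \<and>
      chain_transport n g ` Z \<subseteq> chain_space.span (S \<union> chain_transport n g ` B)) \<longleftrightarrow>
      (\<exists>S. finite S \<and> S \<subseteq> Z \<and> card S = m \<and> Z \<subseteq> chain_space.span (S \<union> B))" for m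
  proof
    assume "\<exists>S. finite S \<and> S \<subseteq> chain_transport n g ` Z \<and> card S = m \<and>
      chain_transport n g ` Z \<subseteq> chain_space.span (S \<union> chain_transport n g ` B)"
    then obtain S where "finite S" "S \<subseteq> chain_transport n g ` Z" "card S = m"
      "chain_transport n g ` Z \<subseteq> chain_space.span (S \<union> chain_transport n g ` B)" by auto
    then show "\<exists>S. finite S \<and> S \<subseteq> Z \<and> card S = m \<and> Z \<subseteq> chain_space.span (S \<union> B)"
      using push[of S "chain_transport n g ` Z" "chain_transport n g ` B" "inv g"]
        bij_imp_bij_inv[OF assms] by (simp add: undo)
  next
    assume "\<exists>S. finite S \<and> S \<subseteq> Z \<and> card S = m \<and> Z \<subseteq> chain_space.span (S \<union> B)"
    then obtain S where "finite S" "S \<subseteq> Z" "card S = m" "Z \<subseteq> chain_space.span (S \<union> B)" by auto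
    then show "\<exists>S. finite S \<and> S \<subseteq> chain_transport n g ` Z \<and> card S = m \<and>
      chain_transport n g ` Z \<subseteq> chain_space.span (S \<union> chain_transport n g ` B)"
      using push[of S Z B g] assms by simp
  qed
  then show ?thesis unfolding chain_space.reldim_def by simp
qed

context chain_subcomplex
begin

text \<open>At a point of a simplex, \<psi> \<circ> g takes the value that \<psi> takes at the moved
  point. The stability of \<open>Cbar\<close> under the action makes the inclusion an
  equality.\<close>

lemma sublevel_transport:
  assumes "bij g" "chain_act n g ` Cbar n = Cbar n"
  shows "chain_transport n g ` sublevel_chains Cbar (\<psi> \<circ> g) n u = sublevel_chains Cbar \<psi> n u"
proof -
  have act: "chain_act n g c = chain_transport n g c" if "c \<in> Cbar n" for c
    using chain_act_eq_transport[OF assms(1)] chains that by blast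
  have "chain_transport n g ` Cbar n = chain_act n g ` Cbar n" using act by simp
  then have im: "chain_transport n g ` Cbar n = Cbar n" using assms(2) by simp
  have "ev_le (induced_filt \<psi> n (chain_transport n g c)) u \<longleftrightarrow> ev_le (induced_filt (\<psi> \<circ> g) n c) u" for c
    by (simp add: ev_le_induced_filt supp_chain_transport[OF assms(1)] simplex_transport_def)
  then have "chain_transport n g ` {c \<in> Cbar n. ev_le (induced_filt (\<psi> \<circ> g) n c) u} =
      {c \<in> chain_transport n g ` Cbar n. ev_le (induced_filt \<psi> n c) u}"
    by auto
  then show ?thesis unfolding sublevel_chains_def im .
qed

lemma PBNF_act:
  assumes "bij g" "\<And>n. chain_act n g ` Cbar n = Cbar n"
  shows "PBNF Cbar (\<psi> \<circ> g) n u v = PBNF Cbar \<psi> n u v"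
proof (cases "0 \<le> n")
  case True
  let ?m = "nat n"
  have fin: "finite (supp c)" if "c \<in> sublevel_chains Cbar (\<psi> \<circ> g) n u" for c n u
    using that by (auto simp: sublevel_chains_def finite_supp)
  \<comment> \<open>In degree 0 the operator \<open>bd\<close> is zero by definition; commutation
    with \<open>bd\<close> is available only in positive degrees.\<close>
  have zero: "bd ?m (chain_transport ?m g c) = (\<lambda>_. 0) \<longleftrightarrow> bd ?m c = (\<lambda>_. 0)"
    if c: "c \<in> sublevel_chains Cbar (\<psi> \<circ> g) ?m u" for c
  proof (cases ?m)
    case 0
    then show ?thesis by (simp add: bd_def)
  next
    case (Suc k)
    have "chain_transport k g d = (\<lambda>_. 0) \<longleftrightarrow> d = (\<lambda>_. 0)" for d :: "('a, 'k) chain"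
    proof
      assume "chain_transport k g d = (\<lambda>_. 0)"
      then show "d = (\<lambda>_. 0)"
        using chain_transport_inverse(1)[OF assms(1), of k d] by (simp add: chain_transport_def)
    qed (simp add: chain_transport_def)
    then show ?thesis using bd_chain_transport[OF assms(1) fin[OF c]] Suc by simp
  qed
  have "chain_transport ?m g ` cycles_below Cbar (\<psi> \<circ> g) ?m u = cycles_below Cbar \<psi> ?m u"
    unfolding cycles_below_def sublevel_transport[OF assms(1) assms(2), where \<psi> = \<psi> and n = ?m and u = u, symmetric]
    by (auto simp: zero)
  moreover have "chain_transport ?m g ` boundaries_below Cbar (\<psi> \<circ> g) ?m v = boundaries_below Cbar \<psi> ?m v"
    unfolding boundaries_below_def sublevel_transport[OF assms(1) assms(2), where \<psi> = \<psi> and n = "Suc ?m" and u = v, symmetric]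
      image_image
    by (intro image_cong refl) (simp add: bd_chain_transport[OF assms(1)] fin)
  ultimately show ?thesis
    using reldim_chain_transport[OF assms(1), of ?m "cycles_below Cbar (\<psi> \<circ> g) ?m u"
        "boundaries_below Cbar (\<psi> \<circ> g) ?m v"] True
    by (simp add: PBNF_eq_reldim)
qed (simp add: PBNF_def)

end

section \<open>Stability of the matching distance\<close>

context relative_dimension
begin

lemma rank_region_flags:
  fixes Z B :: "real \<Rightarrow> 'b set"
  assumes Z: "\<And>u u'. u \<le> u' \<Longrightarrow> Z u \<subseteq> Z u'" and B: "\<And>v v'. v \<le> v' \<Longrightarrow> B v \<subseteq> B v'"
    and fin: "\<And>u v. u + c < v \<Longrightarrow> relfin (Z u) (B v)"
    and low: "\<exists>a. \<forall>u<a. \<forall>B. reldim (Z u) B = 0"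
  shows "rank_region (\<lambda>u v. reldim (Z u) (B v)) c"
proof
  show "reldim (Z u) (B v) \<le> reldim (Z u') (B v)" if "u \<le> u'" "u' + c < v" for u u' v
    using that by (intro reldim_mono Z fin)
  show "reldim (Z u) (B v') \<le> reldim (Z u) (B v)" if "u + c < v" "v \<le> v'" for u v v'
    using that by (intro reldim_antimono B fin)
  show "reldim (Z u) (B v) + reldim (Z u') (B v') \<le> reldim (Z u') (B v) + reldim (Z u) (B v')"
    if "u \<le> u'" "u' + c < v" "v \<le> v'" for u u' v v'
    using that by (intro reldim_modular Z B fin)
  show "\<exists>a. \<forall>u<a. \<forall>v. u + c < v \<longrightarrow> reldim (Z u) (B v) = 0"
    using low by blast
qed

text \<open>The comparisons at fixed births are \<open>reldim_modular\<close> for cycles within one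
  flag and boundaries passing between the flags; those at fixed deaths exchange the roles.
  Finiteness for the mixed pair is inherited from \<open>Z\<^sub>2 (u + \<epsilon>)\<close>.\<close>

lemma interleaved_flags:
  fixes Z\<^sub>1 B\<^sub>1 Z\<^sub>2 B\<^sub>2 :: "real \<Rightarrow> 'b set"
  assumes "0 \<le> \<epsilon>"
    and Z1: "\<And>u u'. u \<le> u' \<Longrightarrow> Z\<^sub>1 u \<subseteq> Z\<^sub>1 u'" and B1: "\<And>v v'. v \<le> v' \<Longrightarrow> B\<^sub>1 v \<subseteq> B\<^sub>1 v'"
    and Z2: "\<And>u u'. u \<le> u' \<Longrightarrow> Z\<^sub>2 u \<subseteq> Z\<^sub>2 u'" and B2: "\<And>v v'. v \<le> v' \<Longrightarrow> B\<^sub>2 v \<subseteq> B\<^sub>2 v'"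
    and fin1: "\<And>u v. u < v \<Longrightarrow> relfin (Z\<^sub>1 u) (B\<^sub>1 v)"
    and fin2: "\<And>u v. u < v \<Longrightarrow> relfin (Z\<^sub>2 u) (B\<^sub>2 v)"
    and low1: "\<exists>a. \<forall>u<a. \<forall>B. reldim (Z\<^sub>1 u) B = 0"
    and low2: "\<exists>a. \<forall>u<a. \<forall>B. reldim (Z\<^sub>2 u) B = 0"
    and Z12: "\<And>u. Z\<^sub>1 u \<subseteq> Z\<^sub>2 (u + \<epsilon>)" and Z21: "\<And>u. Z\<^sub>2 u \<subseteq> Z\<^sub>1 (u + \<epsilon>)"
    and B12: "\<And>v. B\<^sub>1 v \<subseteq> B\<^sub>2 (v + \<epsilon>)" and B21: "\<And>v. B\<^sub>2 v \<subseteq> B\<^sub>1 (v + \<epsilon>)"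
  shows "interleaved_ranks (\<lambda>u v. reldim (Z\<^sub>1 u) (B\<^sub>1 v)) (\<lambda>u v. reldim (Z\<^sub>1 u) (B\<^sub>2 v))
    (\<lambda>u v. reldim (Z\<^sub>2 u) (B\<^sub>2 v)) \<epsilon>"
proof -
  have fin12: "relfin (Z\<^sub>1 u) (B\<^sub>2 v)" if "u + \<epsilon> < v" for u v
    using reldim_additive(1)[OF Z12 fin2[OF that]] .
  interpret A: rank_region "\<lambda>u v. reldim (Z\<^sub>1 u) (B\<^sub>1 v)" 0
    by (rule rank_region_flags) (simp_all add: Z1 B1 fin1 low1)
  interpret K: rank_region "\<lambda>u v. reldim (Z\<^sub>1 u) (B\<^sub>2 v)" \<epsilon>
    by (rule rank_region_flags) (simp_all add: Z1 B2 fin12 low1)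
  interpret B: rank_region "\<lambda>u v. reldim (Z\<^sub>2 u) (B\<^sub>2 v)" 0
    by (rule rank_region_flags) (simp_all add: Z2 B2 fin2 low2)
  show ?thesis
  proof
    show "0 \<le> \<epsilon>" by fact
    show "reldim (Z\<^sub>1 b) (B\<^sub>2 (w + \<epsilon>)) - reldim (Z\<^sub>1 a) (B\<^sub>2 (w + \<epsilon>)) \<le>
        reldim (Z\<^sub>1 b) (B\<^sub>1 w) - reldim (Z\<^sub>1 a) (B\<^sub>1 w)" if "a \<le> b" "b < w" for a b w
      using reldim_modular[OF Z1[OF that(1)] B12[of w] fin1[OF that(2)]] by linarith
    show "reldim (Z\<^sub>1 b) (B\<^sub>1 (w + \<epsilon>)) - reldim (Z\<^sub>1 a) (B\<^sub>1 (w + \<epsilon>)) \<le>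
        reldim (Z\<^sub>1 b) (B\<^sub>2 w) - reldim (Z\<^sub>1 a) (B\<^sub>2 w)" if "a \<le> b" "b + \<epsilon> < w" for a b w
      using reldim_modular[OF Z1[OF that(1)] B21[of w] fin12[OF that(2)]] by linarith
    show "reldim (Z\<^sub>1 u) (B\<^sub>2 v) - reldim (Z\<^sub>1 u) (B\<^sub>2 w) \<le>
        reldim (Z\<^sub>2 (u + \<epsilon>)) (B\<^sub>2 v) - reldim (Z\<^sub>2 (u + \<epsilon>)) (B\<^sub>2 w)"
      if "u + \<epsilon> < v" "v \<le> w" for u v w
      using reldim_modular[OF Z12[of u] B2[OF that(2)] fin2[OF that(1)]] by linarith
    have fin12': "relfin (Z\<^sub>1 (u + \<epsilon>)) (B\<^sub>2 v)" if "u + 2 * \<epsilon> < v" for u v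
      using that by (intro fin12) simp
    show "reldim (Z\<^sub>2 u) (B\<^sub>2 v) - reldim (Z\<^sub>2 u) (B\<^sub>2 w) \<le>
        reldim (Z\<^sub>1 (u + \<epsilon>)) (B\<^sub>2 v) - reldim (Z\<^sub>1 (u + \<epsilon>)) (B\<^sub>2 w)"
      if "u + 2 * \<epsilon> < v" "v \<le> w" for u v w
      using reldim_modular[OF Z21[of u] B2[OF that(2)] fin12'[OF that(1)]] by linarith
    show "reldim (Z\<^sub>1 u) (B\<^sub>2 v) \<le> reldim (Z\<^sub>2 (u + \<epsilon>)) (B\<^sub>2 v)" if "u + \<epsilon> < v" for u v
      using that by (intro reldim_mono Z12 fin2)
    show "reldim (Z\<^sub>2 u) (B\<^sub>2 v) \<le> reldim (Z\<^sub>1 (u + \<epsilon>)) (B\<^sub>2 v)" if "u + 2 * \<epsilon> < v" for u v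
      using that by (intro reldim_mono Z21 fin12')
  qed
qed

end

text \<open>Compactness bounds the filtering functions from below, so no bar on a line is born
  before some level.\<close>

lemma compact_space_triangulated:
  assumes "triangulated_by X K"
  shows "compact_space X"
proof -
  have K: "finite K" "\<And>S. S \<in> K \<Longrightarrow> compact S"
    using assms unfolding triangulated_by_def simplicial_complex_def
    by (auto dest: compact_simplex)
  then have "compact (\<Union>K)" by (intro compact_Union)
  then have "compact_space (subtopology euclidean (\<Union>K))"
    by (simp add: compact_space_subtopology)
  then show ?thesis
    using assms homeomorphic_compact_space unfolding triangulated_by_def by blast
qed

text \<open>Being the identity off the carrier makes g a bijection of the whole type, so
  \<open>inv g\<close> is its genuine inverse.\<close>

lemma bij_Homeo:
  assumes "g \<in> Homeo X"
  shows "bij g"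
proof -
  have g: "inj_on g (topspace X)" "g ` topspace X = topspace X" "\<And>x. x \<notin> topspace X \<Longrightarrow> g x = x"
    using assms homeomorphic_imp_injective_map homeomorphic_imp_surjective_map
    unfolding Homeo_def by blast+
  have "bij_betw g (topspace X) (topspace X)" using g by (simp add: bij_betw_def)
  moreover have "bij_betw g (- topspace X) (- topspace X)"
    using g(3) by (auto simp: bij_betw_def inj_on_def image_def)
  ultimately have "bij_betw g (topspace X \<union> - topspace X) (topspace X \<union> - topspace X)"
    by (rule bij_betw_combine) auto
  then show ?thesis by simp
qed

lemma low_on_line:
  fixes \<phi> :: "'a \<Rightarrow> real^'m"
  assumes "compact_space X" "continuous_map X euclidean \<phi>" "\<And>i. 0 < l $ i"
  shows "\<exists>a. \<forall>s<a. \<forall>x\<in>topspace X. \<not> (\<forall>i. \<phi> x $ i \<le> (s *\<^sub>R l + b) $ i)"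
proof -
  have "compact (\<phi> ` topspace X)"
    using image_compactin[OF _ assms(2)] assms(1) by (simp add: compact_space_def)
  then have "bounded (\<phi> ` topspace X)" by (rule compact_imp_bounded)
  then obtain r where r: "\<And>x. x \<in> topspace X \<Longrightarrow> norm (\<phi> x) \<le> r"
    unfolding bounded_iff by blast
  \<comment> \<open>Any single coordinate suffices: below the bound chosen for s, it forces the
    level under -r, a lower bound of that component of \<phi>.\<close>
  define i :: 'm where "i = undefined"
  have "\<not> \<phi> x $ i \<le> (s *\<^sub>R l + b) $ i" if "s < (- r - b $ i) / l $ i" "x \<in> topspace X" for s x
  proof -
    have "s * l $ i < - r - b $ i" using that(1) assms(3)[of i] by (simp add: pos_less_divide_eq)
    moreover have "- r \<le> \<phi> x $ i"
      using component_le_norm_cart[of "\<phi> x" i] r[OF that(2)] by linarith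
    ultimately show ?thesis by simp
  qed
  then show ?thesis by blast
qed

text \<open>Advancing the line parameter by \<epsilon> raises coordinate i by \<epsilon> times
  \<open>l $ i\<close>, which is why closeness is weighted by l. This shift interleaves the flags of
  \<phi> and \<psi>.\<close>

lemma (in chain_subcomplex) Dmatch1_line_le:
  fixes \<phi> \<psi> :: "'a \<Rightarrow> real^'m"
  assumes compact: "compact_space X" and star: "property_star X Cbar"
    and cont: "continuous_map X euclidean \<phi>" "continuous_map X euclidean \<psi>"
    and l: "\<And>i. 0 < l $ i" and \<epsilon>: "0 \<le> \<epsilon>"
    and close: "\<And>x i. x \<in> topspace X \<Longrightarrow> \<bar>\<phi> x $ i - \<psi> x $ i\<bar> \<le> \<epsilon> * l $ i"
  shows "Dmatch1 (restrict_line (PBNF Cbar \<phi> n) l b) (restrict_line (PBNF Cbar \<psi> n) l b) \<le> ereal \<epsilon>"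
proof (cases "0 \<le> n")
  case True
  define p where "p s = s *\<^sub>R l + b" for s
  define Z where "Z \<phi> s = cycles_below Cbar \<phi> (nat n) (p s)" for \<phi> and s
  define B where "B \<phi> s = boundaries_below Cbar \<phi> (nat n) (p s)" for \<phi> and s
  have le: "s * l $ i \<le> t * l $ i" if "s \<le> t" for s t i
    using that l[of i] by (simp add: mult_right_mono)
  have less: "s * l $ i < t * l $ i" if "s < t" for s t i
    using that l[of i] by simp
  have p_mono: "\<forall>i. \<theta> x $ i \<le> p t $ i" if "s \<le> t" "\<forall>i. \<theta> x $ i \<le> p s $ i" for \<theta> :: "'a \<Rightarrow> real^'m" and x s t
  proof
    fix i
    have "\<theta> x $ i \<le> s * l $ i + b $ i" using that(2) by (simp add: p_def)
    then show "\<theta> x $ i \<le> p t $ i" using le[OF that(1), of i] by (simp add: p_def)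
  qed
  have Z: "Z \<theta> s \<subseteq> Z \<theta> t" if "s \<le> t" for \<theta> s t
    unfolding Z_def by (rule cycles_mono) (rule p_mono[OF that])
  have B: "B \<theta> s \<subseteq> B \<theta> t" if "s \<le> t" for \<theta> s t
    unfolding B_def by (rule boundaries_mono) (rule p_mono[OF that])
  have fin: "chain_space.relfin (Z \<theta> s) (B \<theta> t)" if "s < t" "continuous_map X euclidean \<theta>" for \<theta> s t
    unfolding Z_def B_def p_def using less[OF that(1)]
    by (intro relfin_cycles_boundaries[OF star that(2)]) simp
  have low: "\<exists>a. \<forall>s<a. \<forall>B. chain_space.reldim (Z \<theta> s) B = 0" if "continuous_map X euclidean \<theta>" for \<theta>
  proof -
    obtain a where "\<forall>s<a. \<forall>x\<in>topspace X. \<not> (\<forall>i. \<theta> x $ i \<le> (s *\<^sub>R l + b) $ i)"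
      using low_on_line[OF compact \<open>continuous_map X euclidean \<theta>\<close> l, of b] by blast
    then have "\<forall>s<a. \<forall>B. chain_space.reldim (Z \<theta> s) B = 0"
      unfolding Z_def p_def using reldim_cycles_eq_0 by blast
    then show ?thesis by blast
  qed
  have shift: "\<forall>i. \<theta>' x $ i \<le> p (s + \<epsilon>) $ i"
    if "x \<in> topspace X" "\<forall>i. \<theta> x $ i \<le> p s $ i" "\<And>i. \<bar>\<theta> x $ i - \<theta>' x $ i\<bar> \<le> \<epsilon> * l $ i" for \<theta> \<theta>' x s
  proof
    fix i
    have "\<theta> x $ i \<le> s * l $ i + b $ i" using that(2) by (simp add: p_def)
    then show "\<theta>' x $ i \<le> p (s + \<epsilon>) $ i"
      using that(3)[of i] by (simp add: p_def algebra_simps)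
  qed
  have close': "\<bar>\<psi> x $ i - \<phi> x $ i\<bar> \<le> \<epsilon> * l $ i" if "x \<in> topspace X" for x i
    using close[OF that, of i] by (simp add: abs_minus_commute)
  have "interleaved_ranks (\<lambda>u v. chain_space.reldim (Z \<phi> u) (B \<phi> v))
      (\<lambda>u v. chain_space.reldim (Z \<phi> u) (B \<psi> v)) (\<lambda>u v. chain_space.reldim (Z \<psi> u) (B \<psi> v)) \<epsilon>"
  proof (rule chain_space.interleaved_flags[OF \<epsilon> Z B Z B fin[OF _ cont(1)] fin[OF _ cont(2)]
      low[OF cont(1)] low[OF cont(2)]])
    fix s
    show "Z \<phi> s \<subseteq> Z \<psi> (s + \<epsilon>)" "B \<phi> s \<subseteq> B \<psi> (s + \<epsilon>)"
      unfolding Z_def B_def using shift[of _ \<phi> s \<psi>] close by (intro cycles_mono boundaries_mono; blast)+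
    show "Z \<psi> s \<subseteq> Z \<phi> (s + \<epsilon>)" "B \<psi> s \<subseteq> B \<phi> (s + \<epsilon>)"
      unfolding Z_def B_def using shift[of _ \<psi> s \<phi>] close' by (intro cycles_mono boundaries_mono; blast)+
  qed
  from interleaved_ranks.bottleneck_le[OF this] show ?thesis
    unfolding Dmatch1_def restrict_line_def PBNF_eq_reldim[OF True] Z_def B_def p_def .
next
  case False
  \<comment> \<open>In negative degree all ranks vanish, and zero functions are trivially
    interleaved.\<close>
  have "interleaved_ranks (\<lambda>_ _. 0) (\<lambda>_ _. 0) (\<lambda>_ _. 0) \<epsilon>"
    using \<epsilon> by unfold_locales auto
  from interleaved_ranks.bottleneck_le[OF this] show ?thesis
    using False unfolding Dmatch1_def restrict_line_def PBNF_def by simp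
qed

theorem mainTheorem3:
  fixes X :: "'a topology"
    and K :: "'b::euclidean_space set set"
    and G :: "('a \<Rightarrow> 'a) set"
    and Cbar :: "nat \<Rightarrow> ('a, 'f::field) chain set"
    and \<phi> \<psi> :: "'a \<Rightarrow> real^'k"
    and n :: int
  assumes "triangulated_by X K"
    and "homeo_subgroup X G"
    and "G_chain_subcomplex X G Cbar"
    and "property_star X Cbar"
    and "continuous_map X euclidean \<phi>"
    and "continuous_map X euclidean \<psi>"
  shows "Dmatch (PBNF Cbar \<phi> n) (PBNF Cbar \<psi> n) \<le> nat_pseudo_dist X G \<phi> \<psi>"
proof -
  interpret chain_subcomplex X Cbar
    using assms(3) unfolding G_chain_subcomplex_def by unfold_locales auto
  show ?thesis
    unfolding nat_pseudo_dist_def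
  proof (rule INF_greatest)
    fix g assume g: "g \<in> G"
    then have "g \<in> Homeo X" using assms(2) by (auto simp: homeo_subgroup_def)
    then have bij: "bij g" and cont_g: "continuous_map X X g"
      using bij_Homeo homeomorphic_imp_continuous_map by (auto simp: Homeo_def)
    define d where "d = Sup ({0} \<union> (\<lambda>x. ereal (supnorm (\<phi> x - \<psi> (g x)))) ` topspace X)"
    \<comment> \<open>Invariance reduces the claim to \<phi> and \<psi> \<circ> g, whose pointwise
      distance is bounded by \<open>d\<close>.\<close>
    have PBNF_g: "PBNF Cbar (\<psi> \<circ> g) n = PBNF Cbar \<psi> n"
      using assms(3) g by (intro ext PBNF_act[OF bij]) (auto simp: G_chain_subcomplex_def)
    \<comment> \<open>This excludes -\<infinity>; for \<infinity> nothing is to be shown, so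
      \<open>d\<close> may be taken real.\<close>
    have d0: "0 \<le> d" unfolding d_def by (intro Sup_upper) simp
    show "Dmatch (PBNF Cbar \<phi> n) (PBNF Cbar \<psi> n) \<le> d"
    proof (cases d)
      case (real \<delta>)
      show ?thesis
        unfolding Dmatch_def
      proof (rule SUP_least)
        fix q assume "q \<in> {(l, b). admissible_pair l (b :: real^'k)}"
        then obtain l b where q: "q = (l, b)" and l: "\<And>i. 0 < l $ i"
          by (auto simp: admissible_pair_def)
        \<comment> \<open>The smallest component of l: a shift by \<delta>/m along the line raises
          every coordinate by at least \<delta>, and the weight m in \<open>Dmatch\<close> turns
          \<delta>/m back into \<delta>.\<close>
        define m where "m = Min (range (\<lambda>i. l $ i))"
        have m_le: "m \<le> l $ i" for i unfolding m_def by (intro Min_le) auto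
        have "m \<in> range (\<lambda>i. l $ i)" unfolding m_def by (intro Min_in) auto
        then have m0: "0 < m" using l by auto
        have "Dmatch1 (restrict_line (PBNF Cbar \<phi> n) l b) (restrict_line (PBNF Cbar (\<psi> \<circ> g) n) l b)
            \<le> ereal (\<delta> / m)"
        proof (rule Dmatch1_line_le[OF compact_space_triangulated[OF assms(1)] assms(4,5)
              continuous_map_compose[OF cont_g assms(6)] l])
          show "0 \<le> \<delta> / m" using d0 real m0 by simp
          fix x i assume "x \<in> topspace X"
          then have "ereal (supnorm (\<phi> x - \<psi> (g x))) \<le> d" unfolding d_def by (intro Sup_upper) auto
          then have "supnorm (\<phi> x - \<psi> (g x)) \<le> \<delta>" using real by simp
          moreover have "\<bar>\<phi> x $ i - \<psi> (g x) $ i\<bar> \<le> supnorm (\<phi> x - \<psi> (g x))"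
            unfolding supnorm_def by (intro Max_ge) auto
          moreover have "\<delta> \<le> \<delta> / m * l $ i"
            using m_le[of i] m0 d0 real by (simp add: pos_le_divide_eq mult_left_mono)
          ultimately show "\<bar>\<phi> x $ i - (\<psi> \<circ> g) x $ i\<bar> \<le> \<delta> / m * l $ i" by simp
        qed
        then have "ereal m * Dmatch1 (restrict_line (PBNF Cbar \<phi> n) l b) (restrict_line (PBNF Cbar \<psi> n) l b)
            \<le> ereal m * ereal (\<delta> / m)"
          unfolding PBNF_g using m0 by (intro ereal_mult_left_mono) auto
        also have "\<dots> = d" using m0 real by simp
        finally show "(case q of (l, b) \<Rightarrow> ereal (Min (range (\<lambda>i. l $ i))) *
            Dmatch1 (restrict_line (PBNF Cbar \<phi> n) l b) (restrict_line (PBNF Cbar \<psi> n) l b)) \<le> d"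
          unfolding q m_def by simp
      qed
    qed (use d0 in auto)
  qed
qed

end
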